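(* For every composition $\alpha$, \[{\mathfrak S}^*_\alpha=\sum_{\beta\le_{\mathrm{lex}}\alpha}L_{\alpha,\beta}\,F_\beta,\] the sum over compositions $\beta$ of $|\alpha|$ lexicographically at most $\alpha$, where $L_{\alpha,\beta}$ is the number of standard immaculate tableaux of shape $\alpha$ and descent composition $\beta$. In particular ${\mathfrak S}^*_\alpha$ is fundamental positive.
   Context: Work over $\mathbb{Q}$. A composition $\alpha=[\alpha_1,\dots,\alpha_m]$ of $n$ is a sequence of positive integers summing to $n$; identify it with $D(\alpha)=\{\alpha_1,\alpha_1+\alpha_2,\dots,\alpha_1+\dots+\alpha_{m-1}\}\subseteq\{1,\dots,n-1\}$, and set $\alpha\le\beta$ iff $D(\beta)\subseteq D(\alpha)$. $\mathsf{NSym}$ is the free associative $\mathbb{Q}$-algebra on $H_1,H_2,\dots$ ($\deg H_i=i$), degree-$n$ part $\mathsf{NSym}_n$; $H_{(a_1,\dots,a_m)}=H_{a_1}\cdots H_{a_m}$, $H_0=1$, $H_{-r}=0$. $\mathsf{QSym}$ has monomial basis $M_\alpha=\sum_{i_1<\dots<i_m}x_{i_1}^{\alpha_1}\cdots x_{i_m}^{\alpha_m}$ and fundamental basis $F_\alpha=\sum_{\beta\le\alpha}M_\beta$, paired with $\mathsf{NSym}$ by $\langle H_\alpha,M_\beta\rangle=\delta_{\alpha,\beta}$; $F^\perp$ is defined by $\langle F^\perp H,G\rangle=\langle H,FG\rangle$; $F_{1^i}=F_{(1,\dots,1)}$ ($i$ ones, $F_{1^0}=1$). $\mathbb{B}_m=\sum_{i\ge0}(-1)^iH_{m+i}F_{1^i}^\perp$;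 ${\mathfrak S}_\alpha=\mathbb{B}_{\alpha_1}\cdots\mathbb{B}_{\alpha_m}(1)$; these form a basis of $\mathsf{NSym}_n$ over compositions of $n$, and ${\mathfrak S}^*_\beta\in\mathsf{QSym}_n$ is the dual basis, $\langle{\mathfrak S}_\alpha,{\mathfrak S}^*_\beta\rangle=\delta_{\alpha,\beta}$. A standard immaculate tableau of shape $\alpha$ is a filling of the diagram of $\alpha$ (row $j$ has $\alpha_j$ left-justified boxes, rows numbered from the top) with $1,\dots,|\alpha|$ each once, increasing along rows left to right and down the first column (no condition on other columns). It has a descent at $i$ if $i+1$ is in a row strictly lower (larger index) than $i$; its descent composition is the composition whose associated set is its set of descents. *)

theory Defs
  imports Complex_Main "HOL-Library.Poly_Mapping"
begin

section \<open>Compositions\<close>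

typedef composition = "{xs :: nat list. 0 \<notin> set xs}"
  morphisms parts Abs_composition
  by (rule exI[of _ "[]"]) simp

setup_lifting type_definition_composition

text \<open>Compositions form the free monoid on the positive integers. It is written additively
  because this is what the convolution product of \<^theory>\<open>HOL-Library.Poly_Mapping\<close> expects.\<close>

instantiation composition :: monoid_add
begin
lift_definition zero_composition :: composition is "[]" by simp
lift_definition plus_composition :: "composition \<Rightarrow> composition \<Rightarrow> composition" is "(@)" by simp
instance by (intro_classes; transfer) simp_all
end

lift_definition ones :: "nat \<Rightarrow> composition" is "\<lambda>i. replicate i 1" by simp

definition comp_size :: "composition \<Rightarrow> nat" where
  "comp_size \<alpha> = sum_list (parts \<alpha>)"

definition comp_set :: "composition \<Rightarrow> nat set" where
  "comp_set \<alpha> = {sum_list (take k (parts \<alpha>)) | k. 1 \<le> k \<and> k < length (parts \<alpha>)}"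

definition comp_le :: "composition \<Rightarrow> composition \<Rightarrow> bool" where
  "comp_le \<alpha> \<beta> \<longleftrightarrow> comp_size \<alpha> = comp_size \<beta> \<and> comp_set \<beta> \<subseteq> comp_set \<alpha>"

definition lex_le :: "composition \<Rightarrow> composition \<Rightarrow> bool" where
  "lex_le \<beta> \<alpha> \<longleftrightarrow> lexordp_eq (parts \<beta>) (parts \<alpha>)"

lemma finite_compositions: "finite {\<alpha>. comp_size \<alpha> = n}"
proof -
  have len: "length xs \<le> sum_list xs" if "0 \<notin> set xs" for xs :: "nat list"
    using that by (induction xs) auto
  have "parts ` {\<alpha>. comp_size \<alpha> = n} \<subseteq> {xs. set xs \<subseteq> {..n} \<and> length xs \<le> n}"
    using len parts by (auto simp: comp_size_def dest: member_le_sum_list)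
  then have "finite (parts ` {\<alpha>. comp_size \<alpha> = n})"
    by (rule finite_subset) (rule finite_lists_length_le, simp)
  then show ?thesis
    by (rule finite_imageD) (simp add: inj_on_def parts_inject)
qed


section \<open>Noncommutative symmetric functions\<close>

text \<open>The free associative algebra on $H_1, H_2, \ldots$ is the monoid algebra of the free
  monoid on the positive integers; the coefficient at \<open>\<alpha>\<close> is that of $H_\alpha$
  (see \<open>single_eq_prod_nsym_H\<close> below).\<close>

type_synonym nsym = "composition \<Rightarrow>\<^sub>0 rat"

definition nsym_H :: "int \<Rightarrow> nsym" where
  "nsym_H r = (if r < 0 then 0 else if r = 0 then 1
               else Poly_Mapping.single (Abs_composition [nat r]) 1)"

lemma single_eq_prod_nsym_H:
  "Poly_Mapping.single \<alpha> 1 = (\<Prod>k\<leftarrow>parts \<alpha>. nsym_H (int k))"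
proof -
  have "Poly_Mapping.single (Abs_composition xs) 1 = (\<Prod>k\<leftarrow>xs. nsym_H (int k))"
    if "0 \<notin> set xs" for xs
    using that
  proof (induction xs)
    case Nil
    show ?case by (simp flip: zero_composition_def)
  next
    case (Cons k xs)
    then have "Abs_composition (k # xs) = Abs_composition [k] + Abs_composition xs"
      by (simp add: plus_composition_def Abs_composition_inverse)
    then have "Poly_Mapping.single (Abs_composition (k # xs)) (1 :: rat)
        = Poly_Mapping.single (Abs_composition [k]) 1 * Poly_Mapping.single (Abs_composition xs) 1"
      by (simp add: mult_single)
    also have "Poly_Mapping.single (Abs_composition [k]) 1 = nsym_H (int k)"
      using Cons.prems by (simp add: nsym_H_def)
    finally show ?case
      using Cons by simp
  qed
  from this[of "parts \<alpha>"] show ?thesis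
    using parts[of \<alpha>] by (simp add: parts_inverse)
qed


section \<open>Formal power series in countably many commuting variables\<close>

text \<open>A monomial $x_0^{e_0} x_1^{e_1} \cdots$ is given by its finitely supported exponent vector.\<close>

typedef pseries = "UNIV :: ((nat \<Rightarrow>\<^sub>0 nat) \<Rightarrow> rat) set"
  morphisms coeff Abs_pseries ..

setup_lifting type_definition_pseries

lemma finite_antidiagonal: "finite {(a, b). a + b = (m :: nat \<Rightarrow>\<^sub>0 nat)}"
proof -
  let ?A = "{a. \<exists>b. a + b = m}"
  have le: "Poly_Mapping.lookup a i \<le> Poly_Mapping.lookup m i" if "a + b = m" for a b i
    using that by (auto simp: lookup_add)
  let ?M = "Max (Poly_Mapping.lookup m ` Poly_Mapping.keys m)"
  have max: "Poly_Mapping.lookup m i \<le> ?M" if "i \<in> Poly_Mapping.keys m" for i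
    using that by simp
  have "Poly_Mapping.lookup ` ?A \<subseteq> {f. \<forall>i.
          (i \<in> Poly_Mapping.keys m \<longrightarrow> f i \<in> {..?M}) \<and>
          (i \<notin> Poly_Mapping.keys m \<longrightarrow> f i = 0)}"
  proof (rule image_subsetI, rule CollectI, rule allI)
    fix a i
    assume "a \<in> ?A"
    then have "Poly_Mapping.lookup a i \<le> Poly_Mapping.lookup m i"
      using le by blast
    then show "(i \<in> Poly_Mapping.keys m \<longrightarrow> Poly_Mapping.lookup a i \<in> {..?M}) \<and>
          (i \<notin> Poly_Mapping.keys m \<longrightarrow> Poly_Mapping.lookup a i = 0)"
      using max[of i] by (metis atMost_iff in_keys_iff le_zero_eq order_trans)
  qed
  then have "finite (Poly_Mapping.lookup ` ?A)"
    by (rule finite_subset) (rule finite_set_of_finite_funs, simp_all)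
  moreover have "inj_on Poly_Mapping.lookup ?A"
    by (rule inj_onI) (simp only: lookup_inject)
  ultimately have "finite ?A"
    by (rule finite_imageD)
  moreover have "{(a, b). a + b = m} \<subseteq> (\<lambda>a. (a, m - a)) ` ?A"
  proof
    fix p
    assume "p \<in> {(a, b). a + b = m}"
    then obtain a b where "p = (a, b)" "a + b = m" by auto
    then show "p \<in> (\<lambda>a. (a, m - a)) ` ?A"
      by (intro image_eqI[of _ _ a]) auto
  qed
  ultimately show ?thesis
    by (rule finite_surj)
qed

instantiation pseries :: comm_ring_1
begin

lift_definition zero_pseries :: pseries is "\<lambda>_. 0" .
lift_definition one_pseries :: pseries is "\<lambda>m. if m = 0 then 1 else 0" .
lift_definition plus_pseries :: "pseries \<Rightarrow> pseries \<Rightarrow> pseries" is "\<lambda>f g m. f m + g m" .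
lift_definition minus_pseries :: "pseries \<Rightarrow> pseries \<Rightarrow> pseries" is "\<lambda>f g m. f m - g m" .
lift_definition uminus_pseries :: "pseries \<Rightarrow> pseries" is "\<lambda>f m. - f m" .
lift_definition times_pseries :: "pseries \<Rightarrow> pseries \<Rightarrow> pseries" is
  "\<lambda>f g m. \<Sum>(a, b) | a + b = m. f a * g b" .

instance
proof
  fix f g h :: pseries
  show "f * g = g * f"
  proof (transfer, rule ext)
    fix f g :: "(nat \<Rightarrow>\<^sub>0 nat) \<Rightarrow> rat" and m
    show "(\<Sum>(a, b) | a + b = m. f a * g b) = (\<Sum>(a, b) | a + b = m. g a * f b)"
      by (rule sum.reindex_bij_witness[of _ "\<lambda>(a, b). (b, a)" "\<lambda>(a, b). (b, a)"])
         (auto simp: add.commute)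
  qed
  show "f * g * h = f * (g * h)"
  proof (transfer, rule ext)
    fix f g h :: "(nat \<Rightarrow>\<^sub>0 nat) \<Rightarrow> rat" and m
    have "(\<Sum>(a, b) | a + b = m. (\<Sum>(c, d) | c + d = a. f c * g d) * h b)
        = (\<Sum>p \<in> {(a, b). a + b = m}. \<Sum>q \<in> {(c, d). c + d = fst p}.
             f (fst q) * g (snd q) * h (snd p))"
      by (auto simp: sum_distrib_right case_prod_unfold intro!: sum.cong)
    also have "\<dots> = (\<Sum>(p, q) \<in> Sigma {(a, b). a + b = m} (\<lambda>p. {(c, d). c + d = fst p}).
             f (fst q) * g (snd q) * h (snd p))"
      by (rule sum.Sigma) (auto simp: finite_antidiagonal)
    also have "\<dots> = (\<Sum>(p, q) \<in> Sigma {(a, b). a + b = m} (\<lambda>p. {(c, d). c + d = snd p}).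
             f (fst p) * (g (fst q) * h (snd q)))"
      by (rule sum.reindex_bij_witness[of _ "\<lambda>((a, b), (c, d)). ((a + c, d), (a, c))"
            "\<lambda>((a, b), (c, d)). ((c, d + b), (d, b))"])
         (auto simp: add.assoc mult.assoc)
    also have "\<dots> = (\<Sum>p \<in> {(a, b). a + b = m}. \<Sum>q \<in> {(c, d). c + d = snd p}.
             f (fst p) * (g (fst q) * h (snd q)))"
      by (rule sum.Sigma[symmetric]) (auto simp: finite_antidiagonal)
    also have "\<dots> = (\<Sum>(a, b) | a + b = m. f a * (\<Sum>(c, d) | c + d = b. g c * h d))"
      by (auto simp: sum_distrib_left case_prod_unfold intro!: sum.cong)
    finally show "(\<Sum>(a, b) | a + b = m. (\<Sum>(c, d) | c + d = a. f c * g d) * h b)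
        = (\<Sum>(a, b) | a + b = m. f a * (\<Sum>(c, d) | c + d = b. g c * h d))" .
  qed
  show "1 * f = f"
  proof (transfer, rule ext)
    fix f :: "(nat \<Rightarrow>\<^sub>0 nat) \<Rightarrow> rat" and m
    have "(\<Sum>(a, b) | a + b = m. (if a = 0 then 1 else 0) * f b)
        = (\<Sum>(a, b) \<in> {(0 :: nat \<Rightarrow>\<^sub>0 nat, m)}. (if a = 0 then 1 else 0) * f b)"
      by (rule sum.mono_neutral_right[OF finite_antidiagonal]) (auto split: if_splits)
    then show "(\<Sum>(a, b) | a + b = m. (if a = 0 then 1 else 0) * f b) = f m" by simp
  qed
  show "(f + g) * h = f * h + g * h"
    by transfer (auto simp: case_prod_unfold distrib_right sum.distrib)
  show "(0 :: pseries) \<noteq> 1"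
    by transfer (auto simp: fun_eq_iff)
qed (transfer; simp add: fun_eq_iff)+

end

lift_definition pscale :: "rat \<Rightarrow> pseries \<Rightarrow> pseries" is "\<lambda>c f m. c * f m" .

interpretation pseries: vector_space pscale
  by unfold_locales (transfer; simp add: fun_eq_iff algebra_simps)+


section \<open>Quasisymmetric functions\<close>

text \<open>The coefficient of a monomial in $M_\alpha$ is the number of index sequences
  $i_1 < \cdots < i_m$ for which $x_{i_1}^{\alpha_1} \cdots x_{i_m}^{\alpha_m}$ is that monomial.\<close>

definition index_monomial :: "nat list \<Rightarrow> nat list \<Rightarrow> nat \<Rightarrow>\<^sub>0 nat" where
  "index_monomial is xs = (\<Sum>(i, k)\<leftarrow>zip is xs. Poly_Mapping.single i k)"

lift_definition qsym_M :: "composition \<Rightarrow> pseries" is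
  "\<lambda>\<alpha> m. of_nat (card {is. sorted_wrt (<) is \<and> length is = length (parts \<alpha>)
                              \<and> index_monomial is (parts \<alpha>) = m})" .

definition qsym_F :: "composition \<Rightarrow> pseries" where
  "qsym_F \<alpha> = (\<Sum>\<beta> | comp_le \<beta> \<alpha>. qsym_M \<beta>)"

definition QSym :: "pseries set" where
  "QSym = pseries.span (range qsym_M)"

definition QSym_deg :: "nat \<Rightarrow> pseries set" where
  "QSym_deg n = pseries.span (qsym_M ` {\<alpha>. comp_size \<alpha> = n})"

text \<open>The bilinear pairing determined by $\langle H_\alpha, M_\beta \rangle = \delta_{\alpha,\beta}$;
  meaningful for \<open>G \<in> QSym\<close>, where \<open>pseries.representation\<close> gives the coefficients in the
  monomial basis.\<close>

definition pairing :: "nsym \<Rightarrow> pseries \<Rightarrow> rat" where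
  "pairing h G = (\<Sum>\<alpha>\<in>Poly_Mapping.keys h.
     Poly_Mapping.lookup h \<alpha> * pseries.representation (range qsym_M) G (qsym_M \<alpha>))"

lemma keys_index_monomial:
  assumes "length is = length xs" "0 \<notin> set xs" "distinct is"
  shows "Poly_Mapping.keys (index_monomial is xs) = set is"
    and "map (Poly_Mapping.lookup (index_monomial is xs)) is = xs"
proof -
  have "Poly_Mapping.keys (index_monomial is xs) = set is \<and>
        map (Poly_Mapping.lookup (index_monomial is xs)) is = xs"
    using assms
  proof (induction "is" xs rule: list_induct2)
    case Nil
    show ?case by (simp add: index_monomial_def)
  next
    case (Cons i js k ys)
    let ?n = "index_monomial js ys"
    have m: "index_monomial (i # js) (k # ys) = Poly_Mapping.single i k + ?n"
      by (simp add: index_monomial_def)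
    have IH: "Poly_Mapping.keys ?n = set js" "map (Poly_Mapping.lookup ?n) js = ys"
      using Cons by auto
    have ne: "i \<notin> set js" "k \<noteq> 0"
      using Cons.prems by auto
    have "Poly_Mapping.lookup ?n i = 0"
      using ne(1) unfolding IH(1)[symmetric] in_keys_iff by simp
    then have "Poly_Mapping.lookup (Poly_Mapping.single i k + ?n) i = k"
      by (simp add: lookup_add)
    moreover have "Poly_Mapping.lookup (Poly_Mapping.single i k + ?n) j = Poly_Mapping.lookup ?n j"
      if "j \<in> set js" for j
    proof -
      have "i \<noteq> j" using that ne by blast
      then show ?thesis by (simp add: lookup_add lookup_single_not_eq)
    qed
    then have "map (Poly_Mapping.lookup (Poly_Mapping.single i k + ?n)) js = ys"
      by (subst IH(2)[symmetric]) (rule map_cong[OF refl])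
    moreover have "Poly_Mapping.keys (Poly_Mapping.single i k + ?n) = insert i (set js)"
      unfolding IH(1)[symmetric] using ne(2)
      by (intro set_eqI) (simp add: in_keys_iff lookup_add lookup_single when_def)
    ultimately show ?case
      by (simp add: m)
  qed
  then show "Poly_Mapping.keys (index_monomial is xs) = set is"
    and "map (Poly_Mapping.lookup (index_monomial is xs)) is = xs" by auto
qed

lemma coeff_qsym_M_packed:
  "coeff (qsym_M \<beta>) (index_monomial [0..<length (parts \<alpha>)] (parts \<alpha>)) = (if \<alpha> = \<beta> then 1 else 0)"
proof -
  let ?js = "[0..<length (parts \<alpha>)]"
  have "{is. sorted_wrt (<) is \<and> length is = length (parts \<beta>)
              \<and> index_monomial is (parts \<beta>) = index_monomial ?js (parts \<alpha>)}
        = (if \<alpha> = \<beta> then {?js} else {})" (is "?S = ?T")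
  proof (rule set_eqI)
    fix xs
    show "xs \<in> ?S \<longleftrightarrow> xs \<in> ?T"
    proof
      assume "xs \<in> ?S"
      then have xs: "sorted_wrt (<) xs" "length xs = length (parts \<beta>)"
        and eq: "index_monomial xs (parts \<beta>) = index_monomial ?js (parts \<alpha>)" by auto
      have d: "distinct xs" using xs(1) by (simp add: strict_sorted_iff)
      have p: "0 \<notin> set (parts \<alpha>)" "0 \<notin> set (parts \<beta>)" using parts by auto
      have "set xs = set ?js"
        using keys_index_monomial(1)[OF xs(2) p(2) d]
          keys_index_monomial(1)[OF _ p(1), of ?js] eq by simp
      then have "xs = ?js"
        using xs(1) by (intro strict_sorted_equal) (auto)
      moreover from this have "parts \<alpha> = parts \<beta>"
        using keys_index_monomial(2)[OF xs(2) p(2) d]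
          keys_index_monomial(2)[OF _ p(1), of ?js] eq by simp
      ultimately show "xs \<in> ?T" by (simp add: parts_inject)
    qed (auto split: if_splits)
  qed
  then show ?thesis by (simp add: qsym_M.rep_eq)
qed

lemma inj_qsym_M: "inj qsym_M"
  by (rule injI) (metis coeff_qsym_M_packed zero_neq_one)

lemma coeff_sum_pscale: "coeff (\<Sum>x\<in>A. pscale (c x) (f x)) m = (\<Sum>x\<in>A. c x * coeff (f x) m)"
  by (induction A rule: infinite_finite_induct)
     (simp_all add: zero_pseries.rep_eq plus_pseries.rep_eq pscale.rep_eq)

lemma independent_qsym_M: "pseries.independent (range qsym_M)"
  unfolding pseries.independent_explicit_module
proof (intro allI impI)
  fix t u v
  assume t: "finite t" "t \<subseteq> range qsym_M" and 0: "(\<Sum>v\<in>t. pscale (u v) v) = 0" and v: "v \<in> t"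
  obtain \<alpha> where \<alpha>: "v = qsym_M \<alpha>" using t v by auto
  let ?m = "index_monomial [0..<length (parts \<alpha>)] (parts \<alpha>)"
  have "coeff w ?m = (if w = v then 1 else 0)" if "w \<in> t" for w
  proof -
    obtain \<beta> where "w = qsym_M \<beta>" using t \<open>w \<in> t\<close> by auto
    then show ?thesis
      using coeff_qsym_M_packed[of \<beta> \<alpha>] inj_qsym_M by (auto simp: \<alpha> inj_eq)
  qed
  then have "(\<Sum>w\<in>t. u w * coeff w ?m) = (\<Sum>w\<in>t. if w = v then u w else 0)"
    by (intro sum.cong) auto
  also have "\<dots> = u v" using t v by simp
  finally show "u v = 0"
    using coeff_sum_pscale[of u "\<lambda>w. w" t ?m] 0 by (simp add: zero_pseries.rep_eq)
qed

lemma pairing_H_M: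
  "pairing (\<Prod>k\<leftarrow>parts \<alpha>. nsym_H (int k)) (qsym_M \<beta>) = (if \<alpha> = \<beta> then 1 else 0)"
proof -
  have "pseries.representation (range qsym_M) (qsym_M \<beta>) = (\<lambda>v. if v = qsym_M \<beta> then 1 else 0)"
    by (rule pseries.representation_basis[OF independent_qsym_M]) simp
  then have "pairing (Poly_Mapping.single \<alpha> 1) (qsym_M \<beta>) = (if \<alpha> = \<beta> then 1 else 0)"
    using inj_qsym_M by (simp add: pairing_def inj_eq)
  then show ?thesis
    by (simp only: single_eq_prod_nsym_H)
qed


section \<open>The immaculate basis and its dual\<close>

definition perp :: "pseries \<Rightarrow> nsym \<Rightarrow> nsym" where
  "perp F h = (THE k. \<forall>G\<in>QSym. pairing k G = pairing h (F * G))"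

text \<open>The sum over \<open>i\<close> has finitely many nonzero terms, because $F_{1^i}^\perp h = 0$
  once \<open>i\<close> exceeds the degree of \<open>h\<close>.\<close>

definition bernstein :: "int \<Rightarrow> nsym \<Rightarrow> nsym" where
  "bernstein m h = Sum_any (\<lambda>i. (- 1) ^ i * nsym_H (m + int i) * perp (qsym_F (ones i)) h)"

definition immaculate :: "composition \<Rightarrow> nsym" where
  "immaculate \<alpha> = foldr (\<lambda>k. bernstein (int k)) (parts \<alpha>) 1"

text \<open>The description is unique because the \<open>immaculate \<alpha>\<close> with \<open>comp_size \<alpha> = n\<close> form a basis
  of the degree-\<open>n\<close> component of \<open>nsym\<close>, which is dual to \<open>QSym_deg n\<close>.\<close>

definition dual_immaculate :: "composition \<Rightarrow> pseries" where
  "dual_immaculate \<beta> = (THE G. G \<in> QSym_deg (comp_size \<beta>) \<and>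
     (\<forall>\<alpha>. comp_size \<alpha> = comp_size \<beta> \<longrightarrow>
        pairing (immaculate \<alpha>) G = (if \<alpha> = \<beta> then 1 else 0)))"


section \<open>Standard immaculate tableaux\<close>

text \<open>A tableau is the list of its rows from top to bottom.\<close>

definition standard_immaculate_tableau :: "composition \<Rightarrow> nat list list \<Rightarrow> bool" where
  "standard_immaculate_tableau \<alpha> T \<longleftrightarrow>
     map length T = parts \<alpha> \<and>
     distinct (concat T) \<and> set (concat T) = {1..comp_size \<alpha>} \<and>
     (\<forall>row\<in>set T. sorted_wrt (<) row) \<and>
     sorted_wrt (<) (map hd T)"

definition descents :: "nat list list \<Rightarrow> nat set" where
  "descents T = {i. \<exists>j k. j < k \<and> k < length T \<and> i \<in> set (T ! j) \<and> i + 1 \<in> set (T ! k)}"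

definition descent_composition :: "nat list list \<Rightarrow> composition" where
  "descent_composition T = (THE \<beta>. comp_size \<beta> = length (concat T) \<and> comp_set \<beta> = descents T)"

definition L_coeff :: "composition \<Rightarrow> composition \<Rightarrow> nat" where
  "L_coeff \<alpha> \<beta> = card {T. standard_immaculate_tableau \<alpha> T \<and> descent_composition T = \<beta>}"

definition fundamental_positive :: "pseries \<Rightarrow> bool" where
  "fundamental_positive G \<longleftrightarrow>
     (\<exists>S c. finite S \<and> (\<forall>\<beta>\<in>S. c \<beta> \<ge> 0) \<and> G = (\<Sum>\<beta>\<in>S. pscale (c \<beta>) (qsym_F \<beta>)))"

end

theory Submission
  imports Defs
begin

text \<open>Let \<open>G\<^sub>\<alpha>\<close> be the right-hand side. Its coefficient at \<open>M\<^sub>\<delta>\<close> is the number of standard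
  immaculate tableaux of shape \<open>\<alpha>\<close> whose descent set is contained in that of \<open>\<delta>\<close>. Reading off the
  rows of 1, 2, ... turns such a tableau into a word that is weakly decreasing on the blocks of
  lengths \<open>\<delta>\<^sub>1, \<delta>\<^sub>2, \<dots>\<close>. In such a word the first block consists of the first row index only;
  deleting this letter everywhere gives \<open>H\<^sub>r\<^sup>\<perp> G\<^sub>\<alpha> = h\<^bsub>a-r\<^esub> G\<^bsub>\<alpha>'\<^esub>\<close> for \<open>\<alpha> = (a, \<alpha>')\<close>, where \<open>H\<^sub>r\<^sup>\<perp>\<close> is
  adjoint to left multiplication by \<open>H\<^sub>r\<close> and strips a first part \<open>r\<close>. Since \<open>F\<^bsub>1^i\<^esub> = e\<^sub>i\<close>, the adjoint
  of the Bernstein operator sends \<open>G\<^sub>\<alpha>\<close> to \<open>\<Sum>\<^sub>i (-1)\<^sup>i e\<^sub>i h\<^bsub>a-m-i\<^esub> G\<^bsub>\<alpha>'\<^esub>\<close>, which is \<open>G\<^bsub>\<alpha>'\<^esub>\<close> if \<open>m = a\<close> and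
  0 otherwise. By induction the \<open>G\<^sub>\<alpha>\<close> are dual to the immaculate functions.\<close>

text \<open>Pairings are computed from coefficients of power series, and a quasisymmetric series is
  determined by its coefficients at monomials without gaps. The factors of such a monomial may have
  gaps, so a product with \<open>sym_h\<close> needs coefficients at all exponent lists; this is why
  contents with zero parts are counted. Deleting the letter 0 can be reversed because the zeros of a
  weakly decreasing block stand at its end: only their number matters, and over the later blocks
  these numbers form the exponent list of an arbitrary monomial of degree \<open>a - r\<close>,
  which is where \<open>sym_h (a - r)\<close> comes from. The same recursion forces the first part
  of the content to be at most \<open>a\<close>, and in the case of equality no zeros are left to
  distribute; this yields the lexicographic bound. That the immaculate functions form a basis is not
  assumed: biorthogonality together with the number of compositions shows that the dual description
  has exactly one solution.\<close>

abbreviation "lookup \<equiv> Poly_Mapping.lookup"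
abbreviation "keys \<equiv> Poly_Mapping.keys"
abbreviation "single \<equiv> Poly_Mapping.single"


section \<open>Exponent vectors\<close>

definition deg :: "(nat \<Rightarrow>\<^sub>0 nat) \<Rightarrow> nat" where
  "deg m = (\<Sum>i\<in>keys m. lookup m i)"

lemma deg_superset:
  assumes "finite A" "keys m \<subseteq> A"
  shows "deg m = (\<Sum>i\<in>A. lookup m i)"
  unfolding deg_def using assms by (intro sum.mono_neutral_left) (auto simp: in_keys_iff)

lemma deg_zero [simp]: "deg 0 = 0"
  by (simp add: deg_def)

lemma deg_add [simp]: "deg (a + b) = deg a + deg b"
proof -
  let ?A = "keys a \<union> keys b"
  have "deg (a + b) = (\<Sum>i\<in>?A. lookup (a + b) i)"
    by (rule deg_superset) (auto simp: in_keys_iff lookup_add)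
  then show ?thesis
    using deg_superset[of ?A a] deg_superset[of ?A b] by (simp add: lookup_add sum.distrib)
qed

lemma deg_single [simp]: "deg (single i k) = k"
  by (simp add: deg_def)

text \<open>The monomial with each variable x_i renamed to x_(s i). The exponents are read through
  \<open>inv s\<close>, so the value is the intended one when \<open>s\<close> is injective.\<close>

lift_definition push :: "(nat \<Rightarrow> nat) \<Rightarrow> (nat \<Rightarrow>\<^sub>0 nat) \<Rightarrow> (nat \<Rightarrow>\<^sub>0 nat)" is
  "\<lambda>s m j. if j \<in> range s then m (inv s j) else 0"
proof -
  fix s :: "nat \<Rightarrow> nat" and m
  assume "finite {i :: nat. m i \<noteq> (0 :: nat)}"
  moreover have "{j. (if j \<in> range s then m (inv s j) else 0) \<noteq> 0} \<subseteq> s ` {i. m i \<noteq> 0}"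
  proof
    fix j
    assume "j \<in> {j. (if j \<in> range s then m (inv s j) else 0) \<noteq> 0}"
    then have "s (inv s j) = j" "m (inv s j) \<noteq> 0"
      by (auto simp: f_inv_into_f split: if_splits)
    then show "j \<in> s ` {i. m i \<noteq> 0}"
      by (intro image_eqI[where x = "inv s j"] CollectI) (erule sym, assumption)
  qed
  ultimately show "finite {j. (if j \<in> range s then m (inv s j) else 0) \<noteq> 0}"
    by (rule finite_surj)
qed

lemma lookup_push: "inj s \<Longrightarrow> lookup (push s m) (s i) = lookup m i"
  by (simp add: push.rep_eq)

lemma lookup_push_notin: "j \<notin> range s \<Longrightarrow> lookup (push s m) j = 0"
  by (simp add: push.rep_eq)

lemma push_eqI:
  assumes "inj s" "\<And>i. lookup n (s i) = lookup m i" "\<And>j. j \<notin> range s \<Longrightarrow> lookup n j = 0"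
  shows "push s m = n"
proof (rule poly_mapping_eqI)
  fix j
  show "lookup (push s m) j = lookup n j"
    using assms by (cases "j \<in> range s") (auto simp: lookup_push lookup_push_notin)
qed

lemma push_add: "inj s \<Longrightarrow> push s (a + b) = push s a + push s b"
  by (rule push_eqI) (simp_all add: lookup_add lookup_push lookup_push_notin)

lemma push_single: "inj s \<Longrightarrow> push s (single i k) = single (s i) k"
  by (rule push_eqI) (auto simp: lookup_single when_def inj_eq)

lemma push_zero [simp]: "push s 0 = 0"
  by (rule poly_mapping_eqI) (simp add: push.rep_eq)

lemma push_inject: "inj s \<Longrightarrow> push s a = push s b \<longleftrightarrow> a = b"
  by (metis lookup_push poly_mapping_eqI)

lemma keys_push: "inj s \<Longrightarrow> keys (push s m) = s ` keys m"
proof (intro set_eqI iffI)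
  fix j
  assume "inj s" "j \<in> keys (push s m)"
  then show "j \<in> s ` keys m"
    by (cases "j \<in> range s") (auto simp: in_keys_iff lookup_push lookup_push_notin)
qed (auto simp: in_keys_iff lookup_push)

lemma deg_push: "inj s \<Longrightarrow> deg (push s m) = deg m"
  unfolding deg_def
  by (subst keys_push, assumption, subst sum.reindex) (auto simp: lookup_push intro: inj_on_subset)

lemma push_surj:
  assumes "inj s" "keys n \<subseteq> range s"
  obtains m where "n = push s m"
proof
  show "n = push s (Poly_Mapping.map_key s n)"
    using assms by (intro push_eqI[symmetric]) (auto simp: map_key.rep_eq in_keys_iff)
qed

text \<open>Zero exponents are allowed, so lists that differ by trailing zeros give the same
  monomial, and injectivity is available only at a fixed length.\<close>

definition mono_of :: "nat list \<Rightarrow> nat \<Rightarrow>\<^sub>0 nat" where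
  "mono_of xs = index_monomial [0..<length xs] xs"

lemma mono_of_Nil [simp]: "mono_of [] = 0"
  by (simp add: mono_of_def index_monomial_def)

lemma mono_of_snoc: "mono_of (xs @ [x]) = mono_of xs + single (length xs) x"
  by (simp add: mono_of_def index_monomial_def)

lemma lookup_mono_of: "lookup (mono_of xs) i = (if i < length xs then xs ! i else 0)"
  by (induction xs rule: rev_induct)
     (auto simp: mono_of_snoc lookup_add lookup_single when_def nth_append)

lemma deg_mono_of [simp]: "deg (mono_of xs) = sum_list xs"
  by (induction xs rule: rev_induct) (auto simp: mono_of_snoc)

lemma mono_of_Cons: "mono_of (x # xs) = single 0 x + push Suc (mono_of xs)"
proof (rule poly_mapping_eqI)
  fix i
  show "lookup (mono_of (x # xs)) i = lookup (single 0 x + push Suc (mono_of xs)) i"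
    by (cases i)
       (auto simp: lookup_mono_of lookup_add lookup_single lookup_push lookup_push_notin)
qed

lemma ex_mono_of:
  obtains xs where "m = mono_of xs"
proof
  let ?k = "Suc (Max (insert 0 (keys m)))"
  show "m = mono_of (map (lookup m) [0..<?k])"
  proof (rule poly_mapping_eqI)
    fix i
    have "i < ?k" if "i \<in> keys m"
      using that by (simp add: less_Suc_eq_le)
    then show "lookup m i = lookup (mono_of (map (lookup m) [0..<?k])) i"
      by (simp add: lookup_mono_of in_keys_iff not_less del: upt_Suc) (metis not_gr0 not_le)
  qed
qed

lemma mono_of_inject: "length xs = length ys \<Longrightarrow> mono_of xs = mono_of ys \<longleftrightarrow> xs = ys"
  by (metis lookup_mono_of nth_equalityI)

lemma mono_of_map2_add:
  "length xs = length ys \<Longrightarrow> mono_of (map2 (+) xs ys) = mono_of xs + mono_of ys"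
  by (rule poly_mapping_eqI) (simp add: lookup_mono_of lookup_add)

text \<open>Exponents cannot cancel, so both factors use only the first \<open>length xs\<close>
  variables. Their lists keep the zeros, which is how gaps enter even if \<open>xs\<close> has
  none.\<close>

lemma mono_of_eq_add:
  assumes "a + b = mono_of xs"
  obtains ys zs where "a = mono_of ys" "b = mono_of zs" "length ys = length xs"
    "length zs = length xs" "map2 (+) ys zs = xs"
proof
  let ?k = "length xs"
  have z: "lookup a i + lookup b i = (if i < ?k then xs ! i else 0)" for i
    using assms by (metis lookup_add lookup_mono_of)
  show "a = mono_of (map (lookup a) [0..<?k])" "b = mono_of (map (lookup b) [0..<?k])"
    by (rule poly_mapping_eqI, use z in \<open>force simp: lookup_mono_of split: if_splits\<close>)+
  show "map2 (+) (map (lookup a) [0..<?k]) (map (lookup b) [0..<?k]) = xs"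
    by (rule nth_equalityI) (use z in auto)
qed simp_all

text \<open>A zero exponent amounts to skipping one variable, and the skip is a strictly increasing
  renaming, under which quasisymmetric coefficients are invariant.\<close>

lemma mono_of_insert_zero:
  "mono_of (xs @ 0 # ys) = push (\<lambda>i. if i < length xs then i else Suc i) (mono_of (xs @ ys))"
proof (rule push_eqI[symmetric])
  show "inj (\<lambda>i. if i < length xs then i else Suc i)"
    by (auto simp: inj_on_def split: if_splits)
  show "lookup (mono_of (xs @ 0 # ys)) (if i < length xs then i else Suc i)
      = lookup (mono_of (xs @ ys)) i" for i
    by (auto simp: lookup_mono_of nth_append Suc_diff_le)
  fix j
  assume "j \<notin> range (\<lambda>i. if i < length xs then i else Suc i)"
  moreover have "j \<in> range (\<lambda>i. if i < length xs then i else Suc i)" if "j \<noteq> length xs"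
    using that by (cases "j < length xs") (auto intro!: image_eqI[of _ _ j] image_eqI[of _ _ "j - 1"])
  ultimately have "j = length xs" by blast
  then show "lookup (mono_of (xs @ 0 # ys)) j = 0"
    by (simp add: lookup_mono_of)
qed

lemma skip_strict_mono: "strict_mono (\<lambda>i. if i < k then i else Suc i :: nat)"
  by (auto simp: strict_mono_def)


section \<open>Quasisymmetric power series\<close>

text \<open>Every monomial arises from its gap-free form by a strictly increasing renaming, so this
  is the usual condition on equal exponent sequences. Phrased with \<open>push\<close>, it passes to
  products by renaming whole factorisations.\<close>

definition quasisymmetric :: "pseries \<Rightarrow> bool" where
  "quasisymmetric f \<longleftrightarrow> (\<forall>s m. strict_mono s \<longrightarrow> coeff f (push s m) = coeff f m)"

definition homogeneous :: "nat \<Rightarrow> pseries \<Rightarrow> bool" where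
  "homogeneous n f \<longleftrightarrow> (\<forall>m. deg m \<noteq> n \<longrightarrow> coeff f m = 0)"

lemmas pseries_eqI = coeff_inject[THEN iffD1, OF ext]

lemma coeff_sum: "coeff (\<Sum>x\<in>A. f x) m = (\<Sum>x\<in>A. coeff (f x) m)"
  by (induction A rule: infinite_finite_induct)
     (simp_all add: zero_pseries.rep_eq plus_pseries.rep_eq)

lemma coeff_mult: "coeff (f * g) m = (\<Sum>(a, b) | a + b = m. coeff f a * coeff g b)"
  by (simp add: times_pseries.rep_eq)

lemma quasisymmetric_mono_of_filter:
  assumes "quasisymmetric f"
  shows "coeff f (mono_of xs) = coeff f (mono_of (filter (\<lambda>x. x \<noteq> 0) xs))"
proof -
  \<comment> \<open>The prefix \<open>us\<close> collects the nonzero exponents already passed, so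
    that a zero can be removed at any position.\<close>
  have "coeff f (mono_of (us @ xs)) = coeff f (mono_of (us @ filter (\<lambda>x. x \<noteq> 0) xs))" for us
  proof (induction xs arbitrary: us)
    case (Cons x xs)
    show ?case
    proof (cases "x = 0")
      case True
      then have "coeff f (mono_of (us @ x # xs)) = coeff f (mono_of (us @ xs))"
        using assms skip_strict_mono by (simp add: quasisymmetric_def mono_of_insert_zero)
      then show ?thesis using Cons True by simp
    next
      case False
      then show ?thesis using Cons[of "us @ [x]"] by simp
    qed
  qed simp
  from this[of "[]"] show ?thesis by simp
qed

text \<open>Removing zeros brings any exponent list to the parts of a composition without changing
  the coefficient. Identities such as the one between \<open>qsym_F (ones i)\<close> and
  \<open>sym_e i\<close> are checked by this rule.\<close>

lemma quasisymmetric_eqI: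
  assumes "quasisymmetric f" "quasisymmetric g"
    "\<And>\<alpha>. coeff f (mono_of (parts \<alpha>)) = coeff g (mono_of (parts \<alpha>))"
  shows "f = g"
proof (rule pseries_eqI)
  fix m
  obtain xs where m: "m = mono_of xs" by (rule ex_mono_of)
  have "parts (Abs_composition (filter (\<lambda>x. x \<noteq> 0) xs)) = filter (\<lambda>x. x \<noteq> 0) xs"
    by (simp add: Abs_composition_inverse)
  then show "coeff f m = coeff g m"
    using assms unfolding m by (metis quasisymmetric_mono_of_filter)
qed

text \<open>A factor of a monomial involves only variables of that monomial, so the factorisations
  of \<open>push s m\<close> are exactly the renamed factorisations of \<open>m\<close>.\<close>

lemma quasisymmetric_mult:
  assumes "quasisymmetric f" "quasisymmetric g"
  shows "quasisymmetric (f * g)"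
  unfolding quasisymmetric_def
proof (intro allI impI)
  fix s :: "nat \<Rightarrow> nat" and m
  assume s: "strict_mono s"
  then have inj: "inj s" by (rule strict_mono_imp_inj_on)
  have "bij_betw (map_prod (push s) (push s)) {(a, b). a + b = m} {(a, b). a + b = push s m}"
  proof (rule bij_betw_imageI)
    show "inj_on (map_prod (push s) (push s)) {(a, b). a + b = m}"
      using inj by (auto simp: inj_on_def push_inject)
    show "map_prod (push s) (push s) ` {(a, b). a + b = m} = {(a, b). a + b = push s m}"
    proof (intro set_eqI iffI)
      fix p
      assume "p \<in> {(a, b). a + b = push s m}"
      then obtain a b where p: "p = (a, b)" "a + b = push s m" by auto
      have "keys a \<subseteq> keys (a + b)" "keys b \<subseteq> keys (a + b)"
        by (auto simp: in_keys_iff lookup_add)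
      then have "keys a \<subseteq> range s" "keys b \<subseteq> range s"
        using inj by (auto simp: p keys_push)
      then obtain a' b' where "a = push s a'" "b = push s b'"
        using push_surj[OF inj] by metis
      then show "p \<in> map_prod (push s) (push s) ` {(a, b). a + b = m}"
        using p inj by (auto simp: push_inject simp flip: push_add intro!: image_eqI[of _ _ "(a', b')"])
    qed (use inj in \<open>auto simp: push_add\<close>)
  qed
  from sum.reindex_bij_betw[OF this, of "\<lambda>(a, b). coeff f a * coeff g b"]
  show "coeff (f * g) (push s m) = coeff (f * g) m"
    using assms s by (simp add: coeff_mult case_prod_unfold quasisymmetric_def)
qed

lemma homogeneous_mult:
  assumes "homogeneous i f" "homogeneous j g"
  shows "homogeneous (i + j) (f * g)"
  unfolding homogeneous_def coeff_mult
proof (intro allI impI sum.neutral ballI)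
  fix m p
  assume "deg m \<noteq> i + j" "p \<in> {(a, b). a + b = m}"
  then have "deg (fst p) \<noteq> i \<or> deg (snd p) \<noteq> j"
    by auto
  then show "(case p of (a, b) \<Rightarrow> coeff f a * coeff g b) = 0"
    using assms by (auto simp: homogeneous_def case_prod_unfold)
qed

text \<open>Applying \<open>s\<close> to index sequences is a bijection between those counted at
  \<open>m\<close> and at \<open>push s m\<close>. It is onto because the parts are nonzero: the
  indices are then the support of the monomial and lie in the range of \<open>s\<close>.\<close>

lemma quasisymmetric_qsym_M: "quasisymmetric (qsym_M \<alpha>)"
  unfolding quasisymmetric_def
proof (intro allI impI)
  fix s :: "nat \<Rightarrow> nat" and m
  assume s: "strict_mono s"
  then have inj: "inj s" by (rule strict_mono_imp_inj_on)
  let ?xs = "parts \<alpha>"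
  let ?S = "\<lambda>m. {is. sorted_wrt (<) is \<and> length is = length ?xs \<and> index_monomial is ?xs = m}"
  have im: "index_monomial (map s is) xs = push s (index_monomial is xs)" for "is" xs
    by (induction "is" xs rule: list_induct2')
       (simp_all add: index_monomial_def push_add push_single inj)
  have less: "s i < s j \<longleftrightarrow> i < j" for i j
    using s by (rule strict_mono_less)
  have "bij_betw (map s) (?S m) (?S (push s m))"
  proof (rule bij_betw_imageI)
    show "inj_on (map s) (?S m)"
      using inj by (auto simp: inj_on_def dest: inj_mapD)
    show "map s ` ?S m = ?S (push s m)"
    proof (intro set_eqI iffI)
      fix js
      assume js: "js \<in> ?S (push s m)"
      then have "keys (push s m) = set js"
        using keys_index_monomial(1)[of js ?xs] parts[of \<alpha>] by (auto simp: strict_sorted_iff)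
      then have "set js \<subseteq> range s"
        using inj by (auto simp: keys_push)
      then have "js = map s (map (inv s) js)"
        by (auto simp: map_idI f_inv_into_f subset_iff)
      then obtain ks where "js = map s ks" by blast
      then show "js \<in> map s ` ?S m"
        using js inj by (auto simp: im push_inject sorted_wrt_map less)
    qed (auto simp: im sorted_wrt_map less)
  qed
  then show "coeff (qsym_M \<alpha>) (push s m) = coeff (qsym_M \<alpha>) m"
    by (simp add: qsym_M.rep_eq bij_betw_same_card)
qed

lemma homogeneous_qsym_M: "homogeneous (comp_size \<alpha>) (qsym_M \<alpha>)"
proof -
  have "deg (index_monomial is xs) = sum_list xs" if "length is = length xs" for "is" xs
    using that by (induction "is" xs rule: list_induct2) (simp_all add: index_monomial_def)
  then have empty: "{is. sorted_wrt (<) is \<and> length is = length (parts \<alpha>)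
      \<and> index_monomial is (parts \<alpha>) = m} = {}" if "deg m \<noteq> comp_size \<alpha>" for m
    using that by (auto simp: comp_size_def)
  show ?thesis
    unfolding homogeneous_def qsym_M.rep_eq
  proof (intro allI impI)
    fix m
    assume "deg m \<noteq> comp_size \<alpha>"
    from empty[OF this]
    show "rat_of_nat (card {is. sorted_wrt (<) is \<and> length is = length (parts \<alpha>)
        \<and> index_monomial is (parts \<alpha>) = m}) = 0"
      by (simp only: card.empty of_nat_0)
  qed
qed

lemma coeff_qsym_M_mono_of: "coeff (qsym_M \<beta>) (mono_of (parts \<alpha>)) = (if \<alpha> = \<beta> then 1 else 0)"
  unfolding mono_of_def by (rule coeff_qsym_M_packed)

lemma quasisymmetric_zero: "quasisymmetric 0"
  by (simp add: quasisymmetric_def zero_pseries.rep_eq)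

lemma quasisymmetric_pscale: "quasisymmetric f \<Longrightarrow> quasisymmetric (pscale c f)"
  by (simp add: quasisymmetric_def pscale.rep_eq)

lemma quasisymmetric_sum: "(\<And>x. x \<in> A \<Longrightarrow> quasisymmetric (f x)) \<Longrightarrow> quasisymmetric (\<Sum>x\<in>A. f x)"
  by (simp add: quasisymmetric_def coeff_sum)

lemma QSym_induct [consumes 1, case_names zero step]:
  assumes "G \<in> QSym" "P 0"
    "\<And>c \<alpha> y. y \<in> QSym \<Longrightarrow> P y \<Longrightarrow> P (pscale c (qsym_M \<alpha>) + y)"
  shows "P G"
proof -
  have "G \<in> QSym \<and> P G"
    using assms(1) unfolding QSym_def
  proof (induction rule: pseries.span_induct_alt)
    case base
    show ?case using assms(2) by (simp add: pseries.span_zero)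
  next
    case (step c x y)
    then show ?case
      using assms(3)[of y c] by (auto simp: QSym_def pseries.span_add pseries.span_scale pseries.span_base)
  qed
  then show ?thesis ..
qed

text \<open>Homogeneity leaves finitely many compositions, so the expansion with the gap-free
  coefficients is a finite sum and therefore lies in the span.\<close>

lemma quasisymmetric_homogeneous_in_QSym_deg:
  assumes "quasisymmetric f" "homogeneous n f"
  shows "f \<in> QSym_deg n"
proof -
  let ?A = "{\<alpha>. comp_size \<alpha> = n}"
  let ?g = "\<Sum>\<alpha>\<in>?A. pscale (coeff f (mono_of (parts \<alpha>))) (qsym_M \<alpha>)"
  have "f = ?g"
  proof (rule quasisymmetric_eqI)
    show "quasisymmetric ?g"
      by (intro quasisymmetric_sum quasisymmetric_pscale quasisymmetric_qsym_M)
    fix \<beta>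
    show "coeff f (mono_of (parts \<beta>)) = coeff ?g (mono_of (parts \<beta>))"
      using assms(2)
      by (simp add: coeff_sum_pscale coeff_qsym_M_mono_of homogeneous_def if_distrib
            sum.delta'[OF finite_compositions] cong: if_cong)
         (simp add: comp_size_def)
  qed (fact assms)
  moreover have "?g \<in> QSym_deg n"
    unfolding QSym_deg_def
    by (intro pseries.span_sum pseries.span_scale pseries.span_base) auto
  ultimately show ?thesis by simp
qed

lemma QSym_deg_subset: "QSym_deg n \<subseteq> QSym"
  unfolding QSym_def QSym_deg_def by (rule pseries.span_mono) auto

lemma mult_add_pscale: "f * (pscale c x + y) = pscale c (f * x) + f * y"
  by (rule pseries_eqI) (simp add: coeff_mult plus_pseries.rep_eq pscale.rep_eq distrib_left
        case_prod_unfold sum.distrib sum_distrib_left mult.left_commute)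

lemma QSym_zero: "0 \<in> QSym"
  by (simp add: QSym_def pseries.span_zero)

lemma QSym_add: "f \<in> QSym \<Longrightarrow> g \<in> QSym \<Longrightarrow> f + g \<in> QSym"
  by (simp add: QSym_def pseries.span_add)

lemma QSym_pscale: "f \<in> QSym \<Longrightarrow> pscale c f \<in> QSym"
  by (simp add: QSym_def pseries.span_scale)

lemma QSym_sum: "(\<And>x. x \<in> A \<Longrightarrow> f x \<in> QSym) \<Longrightarrow> (\<Sum>x\<in>A. f x) \<in> QSym"
  by (simp add: QSym_def pseries.span_sum)

lemma qsym_M_in_QSym: "qsym_M \<alpha> \<in> QSym"
  by (simp add: QSym_def pseries.span_base)

lemma QSym_mult:
  assumes "quasisymmetric f" "homogeneous i f" "g \<in> QSym"
  shows "f * g \<in> QSym"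
  using assms(3)
proof (induction rule: QSym_induct)
  case (step c \<alpha> y)
  have "f * qsym_M \<alpha> \<in> QSym"
    using quasisymmetric_mult[OF assms(1) quasisymmetric_qsym_M]
      homogeneous_mult[OF assms(2) homogeneous_qsym_M]
    by (meson QSym_deg_subset quasisymmetric_homogeneous_in_QSym_deg subsetD)
  then show ?case
    using step by (simp add: mult_add_pscale QSym_add QSym_pscale)
qed (simp add: QSym_zero)

text \<open>This replaces the basis representation in the definition of \<open>pairing\<close> by a
  coefficient of the series itself, which makes the pairing computable.\<close>

lemma representation_qsym_M:
  assumes "G \<in> QSym"
  shows "pseries.representation (range qsym_M) G (qsym_M \<alpha>) = coeff G (mono_of (parts \<alpha>))"
  using assms
proof (induction rule: QSym_induct)
  case zero
  show ?case by (simp add: pseries.representation_zero zero_pseries.rep_eq)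
next
  case (step c \<beta> y)
  have "qsym_M \<beta> \<in> pseries.span (range qsym_M)" "y \<in> pseries.span (range qsym_M)"
    using step by (simp_all add: pseries.span_base QSym_def)
  moreover have "pseries.representation (range qsym_M) (qsym_M \<beta>) (qsym_M \<alpha>)
      = coeff (qsym_M \<beta>) (mono_of (parts \<alpha>))"
    using inj_qsym_M pseries.representation_basis[OF independent_qsym_M, of "qsym_M \<beta>"]
    by (simp add: coeff_qsym_M_mono_of inj_eq)
  ultimately show ?case
    using step independent_qsym_M
    by (simp add: pseries.representation_add pseries.representation_scale pseries.span_scale
          plus_pseries.rep_eq pscale.rep_eq)
qed

section \<open>The pairing as a finite sum of coefficients, and its bilinearity\<close>

lemma pairing_eq_sum:
  assumes "G \<in> QSym" "finite A" "keys h \<subseteq> A"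
  shows "pairing h G = (\<Sum>\<alpha>\<in>A. lookup h \<alpha> * coeff G (mono_of (parts \<alpha>)))"
proof -
  have "pairing h G = (\<Sum>\<alpha>\<in>keys h. lookup h \<alpha> * coeff G (mono_of (parts \<alpha>)))"
    by (simp add: pairing_def representation_qsym_M[OF assms(1)])
  also have "\<dots> = (\<Sum>\<alpha>\<in>A. lookup h \<alpha> * coeff G (mono_of (parts \<alpha>)))"
    using assms by (intro sum.mono_neutral_left) (auto simp: in_keys_iff)
  finally show ?thesis .
qed

lemma pairing_add_left:
  assumes "G \<in> QSym"
  shows "pairing (h + k) G = pairing h G + pairing k G"
proof -
  let ?A = "keys h \<union> keys k"
  have "keys (h + k) \<subseteq> ?A" by (rule keys_add)
  then show ?thesis
    using assms by (simp add: pairing_eq_sum[of G ?A] lookup_add distrib_right sum.distrib)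
qed

lemma pairing_zero_left [simp]: "pairing 0 G = 0"
  by (simp add: pairing_def)

lemma pairing_uminus_left: "pairing (- h) G = - pairing h G"
  by (simp add: pairing_def sum_negf)

lemma pairing_minus_one_power_left: "pairing ((- 1) ^ i * h) G = (- 1) ^ i * pairing h G"
  by (cases "even i") (simp_all add: pairing_uminus_left)

lemma pairing_sum_left:
  "G \<in> QSym \<Longrightarrow> pairing (\<Sum>x\<in>A. f x) G = (\<Sum>x\<in>A. pairing (f x) G)"
  by (induction A rule: infinite_finite_induct) (simp_all add: pairing_add_left)

lemma pairing_add_right:
  "f \<in> QSym \<Longrightarrow> g \<in> QSym \<Longrightarrow> pairing h (f + g) = pairing h f + pairing h g"
  by (simp add: pairing_eq_sum[OF _ finite_keys order_refl] QSym_add plus_pseries.rep_eq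
        distrib_left sum.distrib)

lemma pairing_pscale_right: "f \<in> QSym \<Longrightarrow> pairing h (pscale c f) = c * pairing h f"
  by (simp add: pairing_eq_sum[OF _ finite_keys order_refl] QSym_pscale pscale.rep_eq
        sum_distrib_left mult.left_commute)

lemma pairing_zero_right [simp]: "pairing h 0 = 0"
  using QSym_zero by (simp add: pairing_eq_sum[OF _ finite_keys order_refl] zero_pseries.rep_eq)

lemma pairing_sum_right:
  "(\<And>x. x \<in> A \<Longrightarrow> f x \<in> QSym) \<Longrightarrow> pairing h (\<Sum>x\<in>A. f x) = (\<Sum>x\<in>A. pairing h (f x))"
  by (induction A rule: infinite_finite_induct) (simp_all add: pairing_add_right QSym_sum)

lemma pairing_qsym_M: "pairing h (qsym_M \<alpha>) = lookup h \<alpha>"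
proof -
  have "pairing h (qsym_M \<alpha>)
      = (\<Sum>\<beta>\<in>insert \<alpha> (keys h). lookup h \<beta> * (if \<beta> = \<alpha> then 1 else 0))"
    by (simp add: pairing_eq_sum[OF qsym_M_in_QSym, of "insert \<alpha> (keys h)"] subset_insertI
          coeff_qsym_M_mono_of)
  also have "\<dots> = (\<Sum>\<beta>\<in>insert \<alpha> (keys h). if \<beta> = \<alpha> then lookup h \<beta> else 0)"
    by (rule sum.cong) auto
  also have "\<dots> = lookup h \<alpha>"
    by (subst sum.delta) auto
  finally show ?thesis .
qed

text \<open>Needed because \<open>perp\<close> is a definite description. Taking
  \<open>G = qsym_M \<beta>\<close> forces the coefficient at \<open>\<beta>\<close>; the support is
  finite since the degree of \<open>F * qsym_M \<beta>\<close> must occur in \<open>h\<close>, which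
  bounds the size of \<open>\<beta>\<close>.\<close>

lemma ex_adjoint:
  assumes "quasisymmetric F" "homogeneous i F"
  obtains k where "\<And>G. G \<in> QSym \<Longrightarrow> pairing k G = pairing h (F * G)"
proof -
  let ?f = "\<lambda>\<beta>. pairing h (F * qsym_M \<beta>)"
  note FQ = QSym_mult[OF assms]
  have "{\<beta>. ?f \<beta> \<noteq> 0} \<subseteq> (\<Union>n \<in> {..Max (insert 0 (comp_size ` keys h))}. {\<beta>. comp_size \<beta> = n})"
  proof
    fix \<beta>
    assume "\<beta> \<in> {\<beta>. ?f \<beta> \<noteq> 0}"
    then obtain \<gamma> where "\<gamma> \<in> keys h" "coeff (F * qsym_M \<beta>) (mono_of (parts \<gamma>)) \<noteq> 0"
      using FQ[OF qsym_M_in_QSym, of \<beta>]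
      by (auto simp: pairing_eq_sum[OF _ finite_keys order_refl] elim!: sum.not_neutral_contains_not_neutral)
    moreover from \<open>coeff (F * qsym_M \<beta>) (mono_of (parts \<gamma>)) \<noteq> 0\<close>
    have "comp_size \<gamma> = i + comp_size \<beta>"
      using homogeneous_mult[OF assms(2) homogeneous_qsym_M[of \<beta>]]
      unfolding homogeneous_def comp_size_def by (metis deg_mono_of)
    moreover from \<open>\<gamma> \<in> keys h\<close> have "comp_size \<gamma> \<le> Max (insert 0 (comp_size ` keys h))"
      by (intro Max_ge) auto
    ultimately have "comp_size \<beta> \<le> Max (insert 0 (comp_size ` keys h))"
      by linarith
    then show "\<beta> \<in> (\<Union>n \<in> {..Max (insert 0 (comp_size ` keys h))}. {\<beta>. comp_size \<beta> = n})"
      by auto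
  qed
  then have "finite {\<beta>. ?f \<beta> \<noteq> 0}"
    by (rule finite_subset) (auto simp: finite_compositions)
  then have k: "lookup (Abs_poly_mapping ?f) = ?f"
    by (rule lookup_Abs_poly_mapping)
  show thesis
  proof (rule that)
    fix G
    assume "G \<in> QSym"
    then show "pairing (Abs_poly_mapping ?f) G = pairing h (F * G)"
    proof (induction rule: QSym_induct)
      case (step c \<alpha> y)
      have "pairing (Abs_poly_mapping ?f) (qsym_M \<alpha>) = pairing h (F * qsym_M \<alpha>)"
        by (simp add: pairing_qsym_M k)
      then show ?case
        using step FQ[OF qsym_M_in_QSym] FQ[OF step.hyps]
        by (simp add: mult_add_pscale pairing_add_right pairing_pscale_right QSym_pscale qsym_M_in_QSym)
    qed simp
  qed
qed

lemma perp_unique: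
  assumes "\<And>G. G \<in> QSym \<Longrightarrow> pairing k G = pairing h (F * G)"
  shows "perp F h = k"
  unfolding perp_def
proof (rule the_equality)
  fix k'
  assume "\<forall>G\<in>QSym. pairing k' G = pairing h (F * G)"
  then show "k' = k"
    using assms by (intro poly_mapping_eqI) (metis pairing_qsym_M qsym_M_in_QSym)
qed (use assms in blast)

lemma pairing_perp:
  assumes "quasisymmetric F" "homogeneous i F" "G \<in> QSym"
  shows "pairing (perp F h) G = pairing h (F * G)"
  using assms by (metis ex_adjoint perp_unique)

lemma pairing_eq_0_of_degree:
  assumes "homogeneous n G" "G \<in> QSym" "\<And>\<gamma>. \<gamma> \<in> keys h \<Longrightarrow> comp_size \<gamma> \<noteq> n"
  shows "pairing h G = 0"
  using assms by (auto simp: pairing_eq_sum[OF _ finite_keys order_refl] homogeneous_def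
      comp_size_def intro!: sum.neutral)

text \<open>The product \<open>F * qsym_M \<beta>\<close> has degree at least \<open>i\<close>,
  above every term of \<open>h\<close>. This is what makes the sum defining \<open>bernstein\<close>
  finite.\<close>

lemma perp_eq_0:
  assumes "quasisymmetric F" "homogeneous i F" "\<And>\<gamma>. \<gamma> \<in> keys h \<Longrightarrow> comp_size \<gamma> < i"
  shows "perp F h = 0"
proof (rule poly_mapping_eqI)
  fix \<beta>
  have "lookup (perp F h) \<beta> = pairing h (F * qsym_M \<beta>)"
    using pairing_perp[OF assms(1,2) qsym_M_in_QSym] by (simp add: pairing_qsym_M)
  also have "\<dots> = 0"
    using assms(3) homogeneous_mult[OF assms(2) homogeneous_qsym_M]
      QSym_mult[OF assms(1,2) qsym_M_in_QSym]
    by (intro pairing_eq_0_of_degree) force+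
  finally show "lookup (perp F h) \<beta> = lookup 0 \<beta>" by simp
qed


section \<open>Stripping the first part\<close>

text \<open>On monomials, \<open>strip_first r\<close> maps $M_{(r, \beta)}$ to $M_\beta$ and kills the $M_\alpha$ with
  $\alpha_1 \neq r$ (for \<open>r > 0\<close>); it is adjoint to left multiplication by $H_r$.\<close>

lift_definition strip_first :: "nat \<Rightarrow> pseries \<Rightarrow> pseries" is
  "\<lambda>r f m. f (single 0 r + push Suc m)" .

lemma coeff_strip_first_mono_of: "coeff (strip_first r f) (mono_of xs) = coeff f (mono_of (r # xs))"
  by (simp add: strip_first.rep_eq mono_of_Cons)

lemma quasisymmetric_strip_first:
  assumes "quasisymmetric f"
  shows "quasisymmetric (strip_first r f)"
  unfolding quasisymmetric_def
proof (intro allI impI)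
  fix s :: "nat \<Rightarrow> nat" and m
  assume s: "strict_mono s"
  \<comment> \<open>Extends the renaming of the remaining variables by fixing variable 0, which
    carries the stripped exponent.\<close>
  let ?t = "case_nat 0 (Suc \<circ> s)"
  have t: "strict_mono ?t"
    using s by (auto simp: strict_mono_def split: nat.splits)
  have inj: "inj s" "inj ?t"
    using s t by (auto intro: strict_mono_imp_inj_on)
  have "push ?t (single 0 r + push Suc m) = single 0 r + push Suc (push s m)"
  proof (rule push_eqI)
    show "lookup (single 0 r + push Suc (push s m)) (?t i) = lookup (single 0 r + push Suc m) i" for i
      using inj(1) by (cases i) (simp_all add: lookup_add lookup_push lookup_push_notin lookup_single)
    show "lookup (single 0 r + push Suc (push s m)) j = 0" if "j \<notin> range ?t" for j
    proof (cases j)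
      case 0
      then show ?thesis using that range_eqI[of 0 ?t 0] by simp
    next
      case (Suc l)
      then have "l \<notin> range s"
        using that by (auto simp: image_iff) (metis nat.case(2) comp_apply)
      then show ?thesis
        using Suc by (simp add: lookup_add lookup_push lookup_push_notin lookup_single)
    qed
  qed (fact inj)
  then show "coeff (strip_first r f) (push s m) = coeff (strip_first r f) m"
    using assms t by (simp add: strip_first.rep_eq quasisymmetric_def) metis
qed

text \<open>Multiplying by \<open>H_r\<close> on the left puts \<open>r\<close> in front of every
  composition of \<open>h\<close>, and \<open>strip_first r\<close> reads exactly the coefficients
  at the lists \<open>r # parts \<beta>\<close>.\<close>

lemma pairing_H_mult:
  assumes "r > 0" "G \<in> QSym" "strip_first r G \<in> QSym"
  shows "pairing (nsym_H (int r) * h) G = pairing h (strip_first r G)"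
proof -
  let ?c = "Abs_composition [r]"
  have c: "parts ?c = [r]"
    using assms(1) by (simp add: Abs_composition_inverse)
  have parts_plus: "parts (?c + \<beta>) = r # parts \<beta>" for \<beta>
    by (simp add: plus_composition.rep_eq c)
  have pair_single: "pairing (single \<alpha> q) F = q * coeff F (mono_of (parts \<alpha>))" if "F \<in> QSym" for \<alpha> q F
    using that by (simp add: pairing_eq_sum[of F "{\<alpha>}"])
  have "h = (\<Sum>\<alpha>\<in>keys h. single \<alpha> (lookup h \<alpha>))"
    by (rule poly_mapping_eqI) (simp add: lookup_sum lookup_single when_def in_keys_iff)
  then have "single ?c 1 * h = (\<Sum>\<alpha>\<in>keys h. single (?c + \<alpha>) (lookup h \<alpha>))"
    by (metis (no_types, lifting) sum_distrib_left mult_single mult_1 sum.cong)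
  then have "pairing (single ?c 1 * h) G = pairing h (strip_first r G)"
    using assms by (simp add: pairing_sum_left pair_single parts_plus coeff_strip_first_mono_of
        pairing_eq_sum[OF assms(3) finite_keys order_refl])
  then show ?thesis
    using assms(1) by (simp add: nsym_H_def)
qed


section \<open>Partial sums of compositions\<close>

text \<open>Unlike \<open>comp_set\<close>, this keeps 0 and the total sum. With the end points
  included, the set obeys a plain recursion on the list.\<close>

fun psums :: "nat list \<Rightarrow> nat set" where
  "psums [] = {0}"
| "psums (x # xs) = insert 0 ((+) x ` psums xs)"

lemma psums_eq: "psums xs = {sum_list (take k xs) | k. k \<le> length xs}"
proof (induction xs)
  case (Cons x xs)
  have "{sum_list (take k (x # xs)) | k. k \<le> length (x # xs)}
      = insert 0 ((+) x ` {sum_list (take k xs) | k. k \<le> length xs})" (is "?A = ?B")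
  proof (intro set_eqI iffI)
    fix i
    assume "i \<in> ?A"
    then obtain k where "i = sum_list (take k (x # xs))" "k \<le> length (x # xs)" by auto
    then show "i \<in> ?B" by (cases k) auto
  next
    fix i
    assume "i \<in> ?B"
    then consider "i = 0" | k where "i = x + sum_list (take k xs)" "k \<le> length xs" by auto
    then show "i \<in> ?A"
    proof cases
      case 1
      then show ?thesis by (auto intro!: exI[of _ 0])
    next
      case (2 k)
      then show ?thesis by (auto intro!: exI[of _ "Suc k"])
    qed
  qed
  then show ?case using Cons by simp
qed simp

lemma zero_in_psums [simp]: "0 \<in> psums xs"
  by (cases xs) auto

lemma sum_list_in_psums [simp]: "sum_list xs \<in> psums xs"
  by (induction xs) auto

lemma psums_le: "i \<in> psums xs \<Longrightarrow> i \<le> sum_list xs"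
  by (induction xs arbitrary: i) auto

text \<open>As the parts are positive, the first one is the least nonzero partial sum. Once it is
  known, the remaining sums are a shift of the partial sums of the tail.\<close>

lemma psums_inject:
  "0 \<notin> set xs \<Longrightarrow> 0 \<notin> set ys \<Longrightarrow> psums xs = psums ys \<Longrightarrow> xs = ys"
proof (induction xs arbitrary: ys)
  case Nil
  have "sum_list ys = 0"
    using sum_list_in_psums[of ys] by (simp flip: Nil.prems(3))
  then show ?case
    using Nil.prems(2) by (cases ys) auto
next
  case (Cons x xs)
  have nonzero: "psums zs - {0} = (+) z ` psums zs'" if "zs = z # zs'" "z \<noteq> 0" for z zs zs'
    using that by auto
  have "x + 0 \<in> psums ys"
    using imageI[OF zero_in_psums, of "(+) x" xs] by (simp flip: Cons.prems(3))
  then obtain y ys' where ys: "ys = y # ys'"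
    using Cons.prems by (cases ys) auto
  have eq: "(+) x ` psums xs = (+) y ` psums ys'"
    using Cons.prems nonzero[of "x # xs" x xs] nonzero[OF ys] ys by auto
  have "x \<in> (+) y ` psums ys'" "y \<in> (+) x ` psums xs"
    using eq by (metis add_0_right imageI zero_in_psums)+
  then have "x = y" by auto
  moreover from this have "psums xs = psums ys'"
    using eq by (simp add: inj_image_eq_iff)
  ultimately show ?case
    using Cons ys by auto
qed

text \<open>The least positive element of \<open>S\<close> becomes the first part, and the other
  parts come from \<open>S\<close> shifted down by it, which lies in a shorter interval.\<close>

lemma ex_psums:
  assumes "S \<subseteq> {..n}" "0 \<in> S" "n \<in> S"
  shows "\<exists>xs. 0 \<notin> set xs \<and> psums xs = S"
  using assms
proof (induction n arbitrary: S rule: less_induct)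
  case (less n)
  show ?case
  proof (cases "n = 0")
    case True
    then show ?thesis using less.prems by (intro exI[of _ "[]"]) auto
  next
    case False
    define x where "x = Min (S - {0})"
    have fin: "finite (S - {0})"
      using less.prems finite_subset[of S "{..n}"] by blast
    have "S - {0} \<noteq> {}" using False less.prems by blast
    with fin have x: "x \<in> S - {0}" unfolding x_def by (rule Min_in)
    have min: "x \<le> i" if "i \<in> S - {0}" for i
      using fin that unfolding x_def by (rule Min_le)
    let ?T = "{i. x + i \<in> S}"
    have "n - x < n" "?T \<subseteq> {..n - x}" "0 \<in> ?T" "n - x \<in> ?T"
      using x False less.prems by auto
    then obtain xs where xs: "0 \<notin> set xs" "psums xs = ?T"
      using less.IH by blast
    have "psums (x # xs) = S"
    proof (intro set_eqI iffI)
      fix i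
      assume "i \<in> S"
      then have "i = 0 \<or> i = x + (i - x)"
        using min[of i] le_add_diff_inverse[of x i] by (cases "i = 0") auto
      then show "i \<in> psums (x # xs)"
        using \<open>i \<in> S\<close> xs by (auto simp: image_iff)
    qed (use xs less.prems in auto)
    then show ?thesis
      using xs x by (intro exI[of _ "x # xs"]) auto
  qed
qed

text \<open>Positive parts make the partial sums strictly increasing, so excluding the values 0 and
  \<open>comp_size \<alpha>\<close> is the same as excluding the empty and the full prefix.\<close>

lemma comp_set_eq_psums: "comp_set \<alpha> = psums (parts \<alpha>) - {0, comp_size \<alpha>}"
proof -
  let ?xs = "parts \<alpha>"
  have pos: "sum_list ys > 0" if "ys \<noteq> []" "set ys \<subseteq> set ?xs" for ys
    using that parts[of \<alpha>] by (cases ys) (auto intro!: gr0I)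
  have key: "sum_list (take k ?xs) \<notin> {0, comp_size \<alpha>} \<longleftrightarrow> 1 \<le> k \<and> k < length ?xs"
    if "k \<le> length ?xs" for k
  proof (cases "1 \<le> k \<and> k < length ?xs")
    case True
    then have "take k ?xs \<noteq> []" "drop k ?xs \<noteq> []" by auto
    then have "sum_list (take k ?xs) > 0" "sum_list (drop k ?xs) > 0"
      using pos[OF _ set_take_subset] pos[OF _ set_drop_subset] by blast+
    moreover have "comp_size \<alpha> = sum_list (take k ?xs) + sum_list (drop k ?xs)"
      unfolding comp_size_def by (metis append_take_drop_id sum_list_append)
    ultimately have "sum_list (take k ?xs) \<noteq> 0" "sum_list (take k ?xs) \<noteq> comp_size \<alpha>"
      by linarith+
    then show ?thesis
      using True by blast
  next
    case False
    then have "k = 0 \<or> k = length ?xs" using that by linarith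
    then show ?thesis
      using False by (auto simp: comp_size_def)
  qed
  show ?thesis
    unfolding comp_set_def psums_eq
  proof (intro set_eqI iffI)
    fix i
    assume "i \<in> {sum_list (take k ?xs) | k. 1 \<le> k \<and> k < length ?xs}"
    then obtain k where k: "i = sum_list (take k ?xs)" "1 \<le> k \<and> k < length ?xs" by auto
    then have "i \<notin> {0, comp_size \<alpha>}"
      using key[of k] by simp
    then show "i \<in> {sum_list (take k ?xs) | k. k \<le> length ?xs} - {0, comp_size \<alpha>}"
      using k by auto
  next
    fix i
    assume "i \<in> {sum_list (take k ?xs) | k. k \<le> length ?xs} - {0, comp_size \<alpha>}"
    then have i: "i \<notin> {0, comp_size \<alpha>}" "\<exists>k. i = sum_list (take k ?xs) \<and> k \<le> length ?xs"
      by simp_all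
    then obtain k where k: "i = sum_list (take k ?xs)" "k \<le> length ?xs"
      by blast
    with i(1) have "1 \<le> k \<and> k < length ?xs"
      using key[of k] by simp
    then show "i \<in> {sum_list (take k ?xs) | k. 1 \<le> k \<and> k < length ?xs}"
      using k by auto
  qed
qed

lemma comp_set_subset: "comp_set \<alpha> \<subseteq> {0<..<comp_size \<alpha>}"
proof
  fix i
  assume "i \<in> comp_set \<alpha>"
  then have i: "i \<in> psums (parts \<alpha>)" "i \<noteq> 0" "i \<noteq> comp_size \<alpha>"
    by (simp_all add: comp_set_eq_psums)
  then have "i \<le> comp_size \<alpha>"
    unfolding comp_size_def by (intro psums_le)
  then show "i \<in> {0<..<comp_size \<alpha>}"
    using i by simp
qed

lemma comp_set_subset_iff:
  assumes "comp_size \<alpha> = comp_size \<beta>"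
  shows "comp_set \<alpha> \<subseteq> comp_set \<beta> \<longleftrightarrow> psums (parts \<alpha>) \<subseteq> psums (parts \<beta>)"
  using assms sum_list_in_psums[of "parts \<beta>"] by (auto simp: comp_set_eq_psums comp_size_def)

lemma comp_set_inject:
  assumes "comp_size \<alpha> = comp_size \<beta>" "comp_set \<alpha> = comp_set \<beta>"
  shows "\<alpha> = \<beta>"
proof -
  have "psums (parts \<alpha>) = psums (parts \<beta>)"
    using assms comp_set_subset_iff[of \<alpha> \<beta>] comp_set_subset_iff[of \<beta> \<alpha>] by auto
  then show ?thesis
    using psums_inject[of "parts \<alpha>" "parts \<beta>"] parts[of \<alpha>] parts[of \<beta>] by (simp add: parts_inject)
qed

text \<open>Together with \<open>comp_set_inject\<close> this makes the description in
  \<open>descent_composition\<close> denote.\<close>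

lemma ex_comp_set:
  assumes "S \<subseteq> {0<..<n}"
  shows "\<exists>\<beta>. comp_size \<beta> = n \<and> comp_set \<beta> = S"
proof -
  obtain xs where xs: "0 \<notin> set xs" "psums xs = insert 0 (insert n S)"
    using ex_psums[of "insert 0 (insert n S)" n] assms by fastforce
  have "n \<le> sum_list xs"
    by (rule psums_le) (simp add: xs(2))
  moreover have "sum_list xs \<le> n"
  proof -
    have "psums xs \<subseteq> {..n}"
      using assms unfolding xs(2) by auto
    then show ?thesis
      using sum_list_in_psums[of xs] by blast
  qed
  ultimately have "n = sum_list xs" by simp
  then have "comp_size (Abs_composition xs) = n \<and> comp_set (Abs_composition xs) = S"
    using xs assms by (auto simp: comp_set_eq_psums comp_size_def Abs_composition_inverse)
  then show ?thesis ..
qed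

lemma comp_size_ones [simp]: "comp_size (ones i) = i"
  by (simp add: comp_size_def ones.rep_eq sum_list_replicate)

lemma comp_set_ones: "comp_set (ones i) = {0<..<i}"
proof -
  have "psums (replicate i 1) = {..i}"
  proof (induction i)
    case (Suc i)
    have "insert 0 (Suc ` {..i}) = {..Suc i}"
      by (metis atMost_Suc_eq_insert_0)
    then show ?case using Suc by simp
  qed auto
  then have "comp_set (ones i) = {..i} - {0, i}"
    unfolding comp_set_eq_psums comp_size_ones by (simp add: ones.rep_eq)
  also have "\<dots> = {0<..<i}"
    by (intro set_eqI) (simp, linarith)
  finally show ?thesis .
qed

text \<open>The set of \<open>ones i\<close> is already the whole of \<open>{0<..<i}\<close>, so
  there is nothing finer to sum over.\<close>

lemma qsym_F_ones: "qsym_F (ones i) = qsym_M (ones i)"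
proof -
  have "\<beta> = ones i" if "comp_le \<beta> (ones i)" for \<beta>
  proof (rule comp_set_inject)
    have "comp_set \<beta> \<subseteq> {0<..<i}"
      using that comp_set_subset[of \<beta>] by (simp add: comp_le_def)
    then show "comp_set \<beta> = comp_set (ones i)"
      using that by (auto simp: comp_le_def comp_set_ones)
  qed (use that in \<open>simp add: comp_le_def\<close>)
  then have "{\<beta>. comp_le \<beta> (ones i)} = {ones i}"
    by (auto simp: comp_le_def)
  then show ?thesis by (simp add: qsym_F_def)
qed


section \<open>Elementary and complete symmetric functions\<close>

lift_definition sym_e :: "nat \<Rightarrow> pseries" is
  "\<lambda>i m. if deg m = i \<and> (\<forall>j. lookup m j \<le> 1) then 1 else 0" .

lift_definition sym_h :: "nat \<Rightarrow> pseries" is "\<lambda>i m. if deg m = i then 1 else 0" .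

lemma quasisymmetric_sym_h: "quasisymmetric (sym_h i)"
  by (simp add: quasisymmetric_def sym_h.rep_eq deg_push strict_mono_imp_inj_on)

lemma homogeneous_sym_h: "homogeneous i (sym_h i)"
  by (simp add: homogeneous_def sym_h.rep_eq)

lemma quasisymmetric_sym_e: "quasisymmetric (sym_e i)"
  unfolding quasisymmetric_def
proof (intro allI impI)
  fix s :: "nat \<Rightarrow> nat" and m
  assume "strict_mono s"
  then have inj: "inj s" by (rule strict_mono_imp_inj_on)
  have "(\<forall>j. lookup (push s m) j \<le> 1) \<longleftrightarrow> (\<forall>j. lookup m j \<le> 1)"
    using inj by (metis lookup_push lookup_push_notin rangeE zero_le)
  then show "coeff (sym_e i) (push s m) = coeff (sym_e i) m"
    using inj by (simp only: sym_e.rep_eq deg_push)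
qed

lemma homogeneous_sym_e: "homogeneous i (sym_e i)"
  by (simp add: homogeneous_def sym_e.rep_eq)

text \<open>At a gap-free monomial all exponents are positive; if it is also squarefree they are all
  1, and the degree fixes how many there are.\<close>

lemma qsym_F_ones_eq_sym_e: "qsym_F (ones i) = sym_e i"
proof (rule quasisymmetric_eqI)
  fix \<beta>
  have "parts \<beta> = replicate (sum_list (parts \<beta>)) 1" if le: "\<forall>j. lookup (mono_of (parts \<beta>)) j \<le> 1"
  proof -
    have "x = 1" if x: "x \<in> set (parts \<beta>)" for x
    proof -
      obtain j where "j < length (parts \<beta>)" "x = parts \<beta> ! j"
        using x by (auto simp: in_set_conv_nth)
      then have "x \<le> 1" using le[rule_format, of j] by (simp add: lookup_mono_of)
      moreover have "x \<noteq> 0" using parts[of \<beta>] x by (metis mem_Collect_eq)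
      ultimately show ?thesis by simp
    qed
    then have "parts \<beta> = replicate (length (parts \<beta>)) 1"
      by (metis replicate_eqI)
    then show ?thesis
      by (metis sum_list_replicate mult.right_neutral of_nat_id)
  qed
  then have "deg (mono_of (parts \<beta>)) = i \<and> (\<forall>j. lookup (mono_of (parts \<beta>)) j \<le> 1) \<longleftrightarrow> \<beta> = ones i"
    by (auto simp: lookup_mono_of ones.rep_eq sum_list_replicate simp flip: parts_inject)
  then show "coeff (qsym_F (ones i)) (mono_of (parts \<beta>)) = coeff (sym_e i) (mono_of (parts \<beta>))"
    by (simp only: qsym_F_ones coeff_qsym_M_mono_of sym_e.rep_eq)
qed (auto simp: qsym_F_ones quasisymmetric_qsym_M quasisymmetric_sym_e)

text \<open>Squarefree divisors of a monomial correspond to subsets of its support, so the signed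
  count is the binomial expansion of a power of 1 - 1.\<close>

lemma sum_squarefree_divisors:
  "(\<Sum>(a, b) | a + b = m. if \<forall>j. lookup a j \<le> 1 then (- 1) ^ deg a else 0)
    = (if m = 0 then 1 else 0 :: rat)"
proof -
  define ind :: "nat set \<Rightarrow> nat \<Rightarrow>\<^sub>0 nat" where "ind S = (\<Sum>j\<in>S. single j 1)" for S
  have ind: "lookup (ind S) j = (if j \<in> S then 1 else 0)" if "finite S" for S j
    using that by (simp add: ind_def lookup_sum lookup_single when_def)
  have sub: "finite S" if "S \<in> Pow (keys m)" for S
    using that finite_subset[OF _ finite_keys] by auto
  have keys_ind: "keys (ind S) = S" if "finite S" for S
    using that by (auto simp: in_keys_iff ind split: if_splits)
  have deg_ind: "deg (ind S) = card S" if "finite S" for S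
    using that by (simp add: deg_def keys_ind ind)
  have "(\<Sum>(a, b) | a + b = m. if \<forall>j. lookup a j \<le> 1 then (- 1) ^ deg a else 0)
      = (\<Sum>(a, b) | a + b = m \<and> (\<forall>j. lookup a j \<le> 1). (- 1) ^ deg a :: rat)"
    by (rule sum.mono_neutral_cong_right[OF finite_antidiagonal]) (auto split: if_splits)
  also have "\<dots> = (\<Sum>S\<in>Pow (keys m). (- 1) ^ card S)"
  proof (rule sum.reindex_bij_witness[of _ "\<lambda>S. (ind S, m - ind S)" "\<lambda>p. keys (fst p)"])
    fix p
    assume "p \<in> {(a, b). a + b = m \<and> (\<forall>j. lookup a j \<le> 1)}"
    then obtain a b where p: "p = (a, b)" "a + b = m" "\<And>j. lookup a j \<le> 1" by auto
    have "ind (keys a) = a"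
    proof (rule poly_mapping_eqI)
      fix j
      from p(3)[of j] show "lookup (ind (keys a)) j = lookup a j"
        by (simp add: ind in_keys_iff)
    qed
    then show "(ind (keys (fst p)), m - ind (keys (fst p))) = p"
      and "(- 1) ^ card (keys (fst p)) = (case p of (a, b) \<Rightarrow> (- 1 :: rat) ^ deg a)"
      using p deg_ind[of "keys a"] by auto
    show "keys (fst p) \<in> Pow (keys m)"
      using p by (auto simp: in_keys_iff lookup_add)
  next
    fix S
    assume S: "S \<in> Pow (keys m)"
    note fin = sub[OF S]
    show "keys (fst (ind S, m - ind S)) = S"
      using fin by (simp add: keys_ind)
    have "ind S + (m - ind S) = m"
      using S by (intro poly_mapping_eqI) (auto simp: lookup_add lookup_minus ind[OF fin] in_keys_iff)
    then show "(ind S, m - ind S) \<in> {(a, b). a + b = m \<and> (\<forall>j. lookup a j \<le> 1)}"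
      by (simp add: ind[OF fin])
  qed
  \<comment> \<open>Expanding the product picks, for each variable, the summand -1 (it divides) or 1
    (it does not), which gives the sum over subsets.\<close>
  also have "\<dots> = (\<Prod>j\<in>keys m. - 1 + 1)"
    by (subst prod_add) simp_all
  also have "\<dots> = (if m = 0 then 1 else 0)"
    by (auto simp: card_gt_0_iff)
  finally show ?thesis .
qed

text \<open>The degree \<open>d\<close> part of the identity E(-t) H(t) = 1 of generating functions.
  A factorisation \<open>a + b = m\<close> contributes only at \<open>i = deg a\<close>, which
  leaves a signed count of squarefree divisors.\<close>

lemma alternating_sum_e_h:
  "(\<Sum>i\<le>d. pscale ((- 1) ^ i) (sym_e i * sym_h (d - i))) = (if d = 0 then 1 else 0)"
proof (rule pseries_eqI)
  fix m
  have "coeff (\<Sum>i\<le>d. pscale ((- 1) ^ i) (sym_e i * sym_h (d - i))) m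
      = (\<Sum>i\<le>d. \<Sum>(a, b) | a + b = m. if deg a = i \<and> deg b = d - i \<and> (\<forall>j. lookup a j \<le> 1)
           then (- 1) ^ i else 0)"
    unfolding coeff_sum pscale.rep_eq coeff_mult sum_distrib_left
    by (intro sum.cong) (auto simp: sym_e.rep_eq sym_h.rep_eq)
  also have "\<dots> = (\<Sum>(a, b) | a + b = m. \<Sum>i\<le>d. if deg a = i \<and> deg b = d - i \<and> (\<forall>j. lookup a j \<le> 1)
           then (- 1) ^ i else 0)"
    by (subst sum.swap) (simp add: case_prod_unfold)
  also have "\<dots> = (\<Sum>(a, b) | a + b = m. if deg m = d then
        if \<forall>j. lookup a j \<le> 1 then (- 1) ^ deg a else 0 else 0)"
  proof (intro sum.cong refl)
    fix p
    assume "p \<in> {(a, b). a + b = m}"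
    then obtain a b where p: "p = (a, b)" "m = a + b" by auto
    have "(\<Sum>i\<le>d. if deg a = i \<and> deg b = d - i \<and> (\<forall>j. lookup a j \<le> 1) then (- 1 :: rat) ^ i else 0)
        = (\<Sum>i\<le>d. if i = deg a then if deg b = d - deg a \<and> (\<forall>j. lookup a j \<le> 1)
             then (- 1) ^ deg a else 0 else 0)"
      by (rule sum.cong) auto
    also have "\<dots> = (if deg m = d then if \<forall>j. lookup a j \<le> 1 then (- 1) ^ deg a else 0 else 0)"
      by (subst sum.delta) (auto simp: p)
    finally show "(case p of (a, b) \<Rightarrow> \<Sum>i\<le>d. if deg a = i \<and> deg b = d - i \<and> (\<forall>j. lookup a j \<le> 1)
           then (- 1 :: rat) ^ i else 0) = (case p of (a, b) \<Rightarrow> if deg m = d then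
        if \<forall>j. lookup a j \<le> 1 then (- 1) ^ deg a else 0 else 0)"
      by (simp add: p)
  qed
  also have "\<dots> = (if deg m = d then if m = 0 then 1 else 0 else 0)"
    using sum_squarefree_divisors[of m] by simp
  also have "\<dots> = coeff (if d = 0 then 1 else 0) m"
    by (auto simp: one_pseries.rep_eq zero_pseries.rep_eq)
  finally show "coeff (\<Sum>i\<le>d. pscale ((- 1) ^ i) (sym_e i * sym_h (d - i))) m
      = coeff (if d = 0 then 1 else 0) m" .
qed

lemma sum_pscale_mult: "(\<Sum>x\<in>A. pscale (c x) (f x)) * g = (\<Sum>x\<in>A. pscale (c x) (f x * g))"
proof -
  have "pscale c f * g = pscale c (f * g)" for c f g
    using mult_add_pscale[of g c f 0] by (simp add: mult.commute)
  then show ?thesis by (simp add: sum_distrib_right)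
qed

text \<open>All that enters about \<open>G\<close> is its stripping rule. So one statement covers a
  leading part \<open>a\<close> with remainder \<open>G'\<close> as well as the empty composition,
  for which \<open>G' = 0\<close>.\<close>

lemma pairing_bernstein:
  assumes "m > 0" "G \<in> QSym" "G' \<in> QSym"
    and strip: "\<And>r. r > 0 \<Longrightarrow> strip_first r G = (if r \<le> a then sym_h (a - r) * G' else 0)"
  shows "pairing (bernstein (int m) h) G = (if m = a then pairing h G' else 0)"
proof -
  let ?f = "\<lambda>i. (- 1) ^ i * nsym_H (int m + int i) * perp (qsym_F (ones i)) h"
  \<comment> \<open>Beyond the degrees of \<open>h\<close>, so that \<open>perp\<close> vanishes
    from \<open>K\<close> on, and beyond \<open>a\<close>, so that no index up to
    \<open>a - m\<close> is cut off.\<close>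
  define K where "K = Suc (Max (insert a (comp_size ` keys h)))"
  have K: "a < K" "\<And>\<gamma>. \<gamma> \<in> keys h \<Longrightarrow> comp_size \<gamma> < K"
    by (simp_all add: K_def less_Suc_eq_le)
  have "perp (qsym_F (ones i)) h = 0" if "i \<ge> K" for i
    unfolding qsym_F_ones_eq_sym_e
    by (rule perp_eq_0[OF quasisymmetric_sym_e homogeneous_sym_e]) (use K(2) that in fastforce)
  then have "i < K" if "?f i \<noteq> 0" for i
    using that by (cases "i < K") auto
  then have "{i. ?f i \<noteq> 0} \<subseteq> {..<K}"
    by blast
  then have "bernstein (int m) h = (\<Sum>i<K. ?f i)"
    unfolding bernstein_def by (intro Sum_any.expand_superset) auto
  have hG: "sym_h i * G' \<in> QSym" for i
    by (rule QSym_mult[OF quasisymmetric_sym_h homogeneous_sym_h assms(3)])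
  have ehG: "sym_e i * (sym_h j * G') \<in> QSym" for i j
    by (rule QSym_mult[OF quasisymmetric_sym_e homogeneous_sym_e hG])
  have stripQ: "strip_first r G \<in> QSym" if "r > 0" for r
    using strip[OF that] hG by (simp add: QSym_zero)
  have summand: "pairing (?f i) G = (if m + i \<le> a
      then (- 1) ^ i * pairing h (sym_e i * (sym_h (a - m - i) * G')) else 0)" for i
  proof -
    have "pairing (?f i) G = (- 1) ^ i * pairing (nsym_H (int (m + i)) * perp (sym_e i) h) G"
      by (simp add: mult.assoc pairing_minus_one_power_left qsym_F_ones_eq_sym_e)
    also have "pairing (nsym_H (int (m + i)) * perp (sym_e i) h) G
        = pairing (perp (sym_e i) h) (strip_first (m + i) G)"
      using assms(1,2) stripQ by (intro pairing_H_mult) auto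
    also have "\<dots> = pairing h (sym_e i * strip_first (m + i) G)"
      using assms(1) stripQ
      by (intro pairing_perp[OF quasisymmetric_sym_e homogeneous_sym_e]) auto
    also have "strip_first (m + i) G = (if m + i \<le> a then sym_h (a - m - i) * G' else 0)"
      using strip[of "m + i"] assms(1) by simp
    finally show ?thesis by simp
  qed
  have "pairing (bernstein (int m) h) G = (\<Sum>i<K. pairing (?f i) G)"
    unfolding \<open>bernstein (int m) h = _\<close> by (rule pairing_sum_left[OF assms(2)])
  also have "\<dots> = (\<Sum>i<K. if m + i \<le> a
      then (- 1) ^ i * pairing h (sym_e i * (sym_h (a - m - i) * G')) else 0)"
    by (simp only: summand)
  also have "\<dots> = (if m = a then pairing h G' else 0)"
  proof (cases "m \<le> a")
    case True
    have "(\<Sum>i<K. if m + i \<le> a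
        then (- 1) ^ i * pairing h (sym_e i * (sym_h (a - m - i) * G')) else 0)
        = (\<Sum>i\<le>a - m. (- 1) ^ i * pairing h (sym_e i * (sym_h (a - m - i) * G')))"
      by (rule sum.mono_neutral_cong_right) (use True K(1) in auto)
    also have "\<dots> = pairing h (\<Sum>i\<le>a - m. pscale ((- 1) ^ i) (sym_e i * (sym_h (a - m - i) * G')))"
      using ehG by (simp add: pairing_sum_right QSym_pscale pairing_pscale_right)
    also have "(\<Sum>i\<le>a - m. pscale ((- 1) ^ i) (sym_e i * (sym_h (a - m - i) * G')))
        = (\<Sum>i\<le>a - m. pscale ((- 1) ^ i) (sym_e i * sym_h (a - m - i))) * G'"
      by (simp add: sum_pscale_mult mult.assoc)
    also have "\<dots> = (if a - m = 0 then 1 else 0) * G'"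
      by (simp only: alternating_sum_e_h)
    finally show ?thesis
      using True by auto
  qed auto
  finally show ?thesis .
qed


section \<open>Immaculate words\<close>

text \<open>The first occurrences of the letters come in the order 0, 1, 2, ... without omission.
  For the word of a tableau this expresses the increasing first column.\<close>

definition ordered_first :: "nat list \<Rightarrow> bool" where
  "ordered_first w \<longleftrightarrow> (\<forall>i<length w. {..<w ! i} \<subseteq> set (take i w))"

definition immaculate_word :: "nat list \<Rightarrow> nat list \<Rightarrow> bool" where
  "immaculate_word \<alpha> w \<longleftrightarrow> set w \<subseteq> {..<length \<alpha>} \<and>
     (\<forall>j<length \<alpha>. count_list w j = \<alpha> ! j) \<and> ordered_first w"

section \<open>Deleting the first row from a word\<close>

definition drop_row :: "nat list \<Rightarrow> nat list" where
  "drop_row w = map (\<lambda>x. x - 1) (filter (\<lambda>x. x \<noteq> 0) w)"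

lemma drop_row_simps [simp]:
  "drop_row [] = []" "drop_row (0 # w) = drop_row w" "drop_row (Suc x # w) = x # drop_row w"
  "drop_row (v @ w) = drop_row v @ drop_row w"
  by (simp_all add: drop_row_def)

lemma drop_row_map_Suc [simp]: "drop_row (map Suc c) = c"
  by (induction c) auto

lemma drop_row_replicate [simp]: "drop_row (replicate k 0) = []"
  by (induction k) auto

lemma count_list_replicate: "count_list (replicate k x) y = (if x = y then k else 0)"
  by (induction k) auto

lemma sorted_wrt_ge_replicate [simp]: "sorted_wrt (\<ge>) (replicate k (x :: nat))"
  by (induction k) auto

lemma drop_row_concat: "drop_row (concat bs) = concat (map drop_row bs)"
  by (induction bs) auto

lemma in_set_drop_row_iff: "x \<in> set (drop_row w) \<longleftrightarrow> Suc x \<in> set w"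
proof (induction w)
  case (Cons y w)
  then show ?case by (cases y) auto
qed simp

lemma count_list_drop_row: "count_list (drop_row w) j = count_list w (Suc j)"
proof (induction w)
  case (Cons y w)
  then show ?case by (cases y) auto
qed simp

lemma length_drop_row: "length w = count_list w 0 + length (drop_row w)"
proof (induction w)
  case (Cons y w)
  then show ?case by (cases y) auto
qed simp

lemma ordered_first_snoc:
  "ordered_first (w @ [x]) \<longleftrightarrow> ordered_first w \<and> {..<x} \<subseteq> set w"
  by (simp add: ordered_first_def All_less_Suc nth_append conj_commute cong: conj_cong)

text \<open>A leading 0 is exactly what the presence of 0 before every positive letter demands; the
  conditions among positive letters survive the renumbering.\<close>

lemma ordered_first_drop_row:
  "w \<noteq> [] \<Longrightarrow> ordered_first w \<longleftrightarrow> hd w = 0 \<and> ordered_first (drop_row w)"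
proof (induction w rule: rev_induct)
  case (snoc x w)
  show ?case
  proof (cases "w = []")
    case True
    then show ?thesis
      by (cases x) (auto simp: ordered_first_def)
  next
    case False
    have "{..<x} \<subseteq> set w \<longleftrightarrow> {..<y} \<subseteq> set (drop_row w)" if "x = Suc y" "hd w = 0" for y
    proof -
      have "0 \<in> set w" using False that by (metis hd_in_set)
      then show ?thesis
        by (auto simp: \<open>x = Suc y\<close> lessThan_Suc_eq_insert_0 subset_iff in_set_drop_row_iff)
    qed
    then show ?thesis
      using False snoc.IH by (cases x) (auto simp: ordered_first_snoc)
  qed
qed simp

lemma immaculate_word_Nil [simp]: "immaculate_word [] w \<longleftrightarrow> w = []"
  by (auto simp: immaculate_word_def ordered_first_def)

lemma immaculate_word_Cons:
  assumes "a > 0"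
  shows "immaculate_word (a # \<alpha>) w \<longleftrightarrow>
    w \<noteq> [] \<and> hd w = 0 \<and> count_list w 0 = a \<and> immaculate_word \<alpha> (drop_row w)"
proof (cases "w = []")
  case True
  then show ?thesis using assms by (auto simp: immaculate_word_def)
next
  case False
  have letters: "set w \<subseteq> {..<length (a # \<alpha>)} \<longleftrightarrow> set (drop_row w) \<subseteq> {..<length \<alpha>}"
  proof
    assume "set (drop_row w) \<subseteq> {..<length \<alpha>}"
    then have "x < length (a # \<alpha>)" if "x \<in> set w" for x
      using that in_set_drop_row_iff[of "x - 1" w] by (cases x) auto
    then show "set w \<subseteq> {..<length (a # \<alpha>)}" by blast
  next
    assume "set w \<subseteq> {..<length (a # \<alpha>)}"
    then show "set (drop_row w) \<subseteq> {..<length \<alpha>}"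
      using in_set_drop_row_iff[of _ w] by fastforce
  qed
  have counts: "(\<forall>j<length (a # \<alpha>). count_list w j = (a # \<alpha>) ! j) \<longleftrightarrow>
      count_list w 0 = a \<and> (\<forall>j<length \<alpha>. count_list (drop_row w) j = \<alpha> ! j)"
    by (simp add: All_less_Suc2 count_list_drop_row)
  show ?thesis
    unfolding immaculate_word_def letters counts ordered_first_drop_row[OF False]
    by (simp only: False conj_ac simp_thms)
qed

text \<open>In a weakly decreasing block the zeros form the tail, so the block can be rebuilt from
  its positive letters and the number of zeros.\<close>

lemma weakly_decreasing_split:
  fixes b :: "nat list"
  shows "sorted_wrt (\<ge>) b \<Longrightarrow> b = map Suc (drop_row b) @ replicate (count_list b 0) 0"
proof (induction b)
  case (Cons x b)
  show ?case
  proof (cases x)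
    case 0
    then have zero: "b = replicate (length b) 0"
      using Cons.prems by (auto intro: replicate_eqI)
    then show ?thesis
      using 0 by (metis append_Nil count_list_replicate drop_row_replicate list.simps(8) replicate_Suc length_Cons)
  qed (use Cons in auto)
qed simp

text \<open>A weakly decreasing block is the multiset of row indices of one value in a semistandard
  immaculate tableau, so \<open>num_blocks \<alpha> \<beta>\<close> counts the immaculate tableaux of shape \<open>\<alpha>\<close> and
  content \<open>\<beta>\<close>. Zero parts are allowed in \<open>\<beta>\<close>, which makes it the coefficient of an
  arbitrary monomial.\<close>

definition blocks :: "nat list \<Rightarrow> nat list \<Rightarrow> nat list list set" where
  "blocks \<alpha> \<beta> = {bs. map length bs = \<beta> \<and> (\<forall>b\<in>set bs. sorted_wrt (\<ge>) b) \<and>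
     immaculate_word \<alpha> (concat bs)}"

definition num_blocks :: "nat list \<Rightarrow> nat list \<Rightarrow> nat" where
  "num_blocks \<alpha> \<beta> = card (blocks \<alpha> \<beta>)"

lemma finite_blocks: "finite (blocks \<alpha> \<beta>)"
proof -
  let ?W = "{w. set w \<subseteq> {..<length \<alpha>} \<and> length w \<le> sum_list \<beta>}"
  have "blocks \<alpha> \<beta> \<subseteq> {bs. set bs \<subseteq> ?W \<and> length bs = length \<beta>}"
    by (auto simp: blocks_def immaculate_word_def intro: member_le_sum_list)
  moreover have "finite {bs. set bs \<subseteq> ?W \<and> length bs = length \<beta>}"
    by (intro finite_lists_length_eq finite_lists_length_le) simp
  ultimately show ?thesis by (rule finite_subset)
qed

text \<open>The factorisations, as exponent lists, of the monomial \<open>\<beta>\<close> with first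
  factor of degree \<open>k\<close>. In the recursion \<open>g\<close> records the zeros in each
  block and \<open>d\<close> the lengths left after their deletion.\<close>

definition splits :: "nat list \<Rightarrow> nat \<Rightarrow> (nat list \<times> nat list) set" where
  "splits \<beta> k = {(g, d). length g = length \<beta> \<and> length d = length \<beta> \<and> map2 (+) g d = \<beta> \<and>
     sum_list g = k}"

lemma le_sum_list_map2_add:
  fixes g d :: "nat list"
  assumes "length g = length d" "x \<in> set g \<union> set d"
  shows "x \<le> sum_list (map2 (+) g d)"
  using assms by (induction g d rule: list_induct2) auto

lemma finite_splits: "finite (splits \<beta> k)"
proof -
  let ?L = "{xs. set xs \<subseteq> {..sum_list \<beta>} \<and> length xs = length \<beta>}"
  have "splits \<beta> k \<subseteq> ?L \<times> ?L"
  proof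
    fix p
    assume p: "p \<in> splits \<beta> k"
    obtain g d where gd: "p = (g, d)" by (cases p)
    have len: "length g = length \<beta>" "length d = length \<beta>" "map2 (+) g d = \<beta>"
      using p by (simp_all add: gd splits_def)
    have "x \<le> sum_list \<beta>" if "x \<in> set g \<union> set d" for x
      using le_sum_list_map2_add[of g d x] that len by simp
    then show "p \<in> ?L \<times> ?L"
      using len(1,2) by (auto simp: gd)
  qed
  moreover have "finite (?L \<times> ?L)"
    by (intro finite_cartesian_product finite_lists_length_eq) simp_all
  ultimately show ?thesis by (rule finite_subset)
qed

text \<open>The word starts with 0, and a nonempty weakly decreasing block starting with 0 contains
  nothing else; \<open>r > 0\<close> guarantees that the first block holds the first letter.\<close>

lemma blocks_ConsD:
  assumes "bs \<in> blocks (a # \<alpha>) (r # \<beta>)" "a > 0" "r > 0"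
  obtains cs where "bs = replicate r 0 # cs" "map length cs = \<beta>" "\<forall>c\<in>set cs. sorted_wrt (\<ge>) c"
    "r + sum_list (map (\<lambda>c. count_list c 0) cs) = a" "immaculate_word \<alpha> (concat (map drop_row cs))"
proof -
  obtain b cs where bs: "bs = b # cs" "length b = r" "map length cs = \<beta>"
    using assms(1) by (auto simp: blocks_def)
  have w: "hd (concat bs) = 0" "count_list (concat bs) 0 = a" "immaculate_word \<alpha> (drop_row (concat bs))"
    and sorted: "sorted_wrt (\<ge>) b" "\<forall>c\<in>set cs. sorted_wrt (\<ge>) c"
    using assms(1,2) by (auto simp: blocks_def immaculate_word_Cons bs)
  have "b \<noteq> []" using bs assms(3) by auto
  then have "hd b = 0" using w(1) bs by simp
  then have b: "b = replicate r 0"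
    using sorted(1) bs(2) by (cases b) (auto intro!: replicate_eqI)
  have "count_list (concat cs) 0 = sum_list (map (\<lambda>c. count_list c 0) cs)"
    by (induction cs) auto
  then show ?thesis
    using that[of cs] w sorted(2) bs by (simp add: b drop_row_concat count_list_replicate)
qed

text \<open>The first block uses \<open>r\<close> of the \<open>a\<close> zeros. The other
  \<open>a - r\<close> may be spread over the later blocks in any way that fits the lengths, because
  the leading 0 already settles the order condition for them.\<close>

lemma num_blocks_Cons:
  assumes "a > 0" "r > 0"
  shows "num_blocks (a # \<alpha>) (r # \<beta>)
    = (if r \<le> a then \<Sum>(g, d)\<in>splits \<beta> (a - r). num_blocks \<alpha> d else 0)"
proof (cases "r \<le> a")
  case False
  then have "blocks (a # \<alpha>) (r # \<beta>) = {}"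
    using assms by (auto elim!: blocks_ConsD)
  then show ?thesis using False by (simp add: num_blocks_def)
next
  case True
  \<comment> \<open>\<open>f\<close> separates each later block into its number of zeros and its
    renumbered positive letters; \<open>f'\<close> shifts the letters back and appends the
    zeros.\<close>
  define f where "f = (\<lambda>bs :: nat list list. ((map (\<lambda>b. count_list b 0) (tl bs),
    map (\<lambda>b. length (drop_row b)) (tl bs)), map drop_row (tl bs)))"
  define f' where "f' = (\<lambda>((g :: nat list, d :: nat list), cs).
    replicate r 0 # map2 (\<lambda>c k. map Suc c @ replicate k 0) cs g)"
  let ?S = "Sigma (splits \<beta> (a - r)) (\<lambda>(g, d). blocks \<alpha> d)"
  have "bij_betw f (blocks (a # \<alpha>) (r # \<beta>)) ?S"
  proof (rule bij_betw_byWitness[where f' = f'])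
    show "\<forall>bs\<in>blocks (a # \<alpha>) (r # \<beta>). f' (f bs) = bs"
    proof
      fix bs
      assume "bs \<in> blocks (a # \<alpha>) (r # \<beta>)"
      then obtain cs where cs: "bs = replicate r 0 # cs" "\<forall>c\<in>set cs. sorted_wrt (\<ge>) c"
        using assms by (elim blocks_ConsD)
      then have "map2 (\<lambda>c k. map Suc c @ replicate k 0) (map drop_row cs) (map (\<lambda>b. count_list b 0) cs) = cs"
        by (intro nth_equalityI) (simp_all flip: weakly_decreasing_split)
      then show "f' (f bs) = bs"
        by (simp add: f_def f'_def cs)
    qed
    show "f ` blocks (a # \<alpha>) (r # \<beta>) \<subseteq> ?S"
    proof
      fix p
      assume "p \<in> f ` blocks (a # \<alpha>) (r # \<beta>)"
      then obtain cs where p: "p = f (replicate r 0 # cs)" and cs: "map length cs = \<beta>"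
        "\<forall>c\<in>set cs. sorted_wrt (\<ge>) c" "r + sum_list (map (\<lambda>c. count_list c 0) cs) = a"
        "immaculate_word \<alpha> (concat (map drop_row cs))"
        using assms by (auto elim!: blocks_ConsD)
      have "sorted_wrt (\<ge>) (drop_row c)" if "c \<in> set cs" for c
      proof -
        have "sorted_wrt (\<ge>) (map Suc (drop_row c) @ replicate (count_list c 0) 0)"
          using cs(2) that weakly_decreasing_split[of c] by metis
        then show ?thesis by (simp add: sorted_wrt_append sorted_wrt_map)
      qed
      moreover have "map2 (+) (map (\<lambda>b. count_list b 0) cs) (map (\<lambda>b. length (drop_row b)) cs) = \<beta>"
        unfolding cs(1)[symmetric] by (rule nth_equalityI) (simp_all flip: length_drop_row)
      ultimately show "p \<in> ?S"
        using cs by (auto simp: p f_def splits_def blocks_def)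
    qed
    have inv: "map (\<lambda>b. count_list b 0) (map2 (\<lambda>c k. map Suc c @ replicate k 0) cs g) = g"
      "map drop_row (map2 (\<lambda>c k. map Suc c @ replicate k 0) cs g) = cs"
      "map (\<lambda>b. length (drop_row b)) (map2 (\<lambda>c k. map Suc c @ replicate k 0) cs g) = map length cs"
      "map length (map2 (\<lambda>c k. map Suc c @ replicate k 0) cs g) = map2 (+) g (map length cs)"
      if "length g = length cs" for g and cs :: "nat list list"
      using that by (induction g cs rule: list_induct2)
        (simp_all add: count_list_replicate count_list_0_iff add.commute)
    \<comment> \<open>The component \<open>d\<close> is the list of lengths of the blocks in
      \<open>cs\<close>; in this form the equations \<open>inv\<close> apply directly.\<close>
    have memS: "\<exists>g cs. p = ((g, map length cs), cs) \<and> length g = length cs \<and>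
        map2 (+) g (map length cs) = \<beta> \<and> sum_list g = a - r \<and>
        (\<forall>c\<in>set cs. sorted_wrt (\<ge>) c) \<and> immaculate_word \<alpha> (concat cs)" if "p \<in> ?S" for p
    proof -
      obtain g d cs where p: "p = ((g, d), cs)" by (metis prod.collapse)
      then have "(g, d) \<in> splits \<beta> (a - r)" "cs \<in> blocks \<alpha> d"
        using that by auto
      moreover from \<open>cs \<in> blocks \<alpha> d\<close> have "d = map length cs"
        by (simp add: blocks_def)
      ultimately show ?thesis
        by (simp add: p splits_def blocks_def)
    qed
    show "\<forall>p\<in>?S. f (f' p) = p"
    proof
      fix p
      assume "p \<in> ?S"
      then obtain g cs where "p = ((g, map length cs), cs)" "length g = length cs"
        using memS by blast
      then show "f (f' p) = p"
        using inv[of g cs] by (simp add: f_def f'_def)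
    qed
    show "f' ` ?S \<subseteq> blocks (a # \<alpha>) (r # \<beta>)"
    proof
      fix bs
      assume "bs \<in> f' ` ?S"
      then obtain p where "bs = f' p" "p \<in> ?S" by blast
      with memS obtain g cs where bs: "bs = f' ((g, map length cs), cs)" "length g = length cs"
        and g: "map2 (+) g (map length cs) = \<beta>" "sum_list g = a - r"
        and cs: "\<forall>c\<in>set cs. sorted_wrt (\<ge>) c" "immaculate_word \<alpha> (concat cs)"
        by blast
      let ?bs = "map2 (\<lambda>c k. map Suc c @ replicate k 0) cs g"
      have "sorted_wrt (\<ge>) b" if "b \<in> set ?bs" for b
        using that cs(1) by (auto simp: sorted_wrt_append sorted_wrt_map
            dest!: set_zip_leftD)
      moreover have "sum_list (map (\<lambda>b. count_list b 0) ?bs) = a - r"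
        using inv(1)[OF bs(2)] g(2) by simp
      moreover have "count_list (concat bs) 0 = sum_list (map (\<lambda>b. count_list b 0) bs)" for bs :: "nat list list"
        by (induction bs) auto
      ultimately show "bs \<in> blocks (a # \<alpha>) (r # \<beta>)"
        using inv(2,4)[OF bs(2)] cs(2) g(1) assms True
        by (auto simp: bs(1) f'_def blocks_def immaculate_word_Cons drop_row_concat
            count_list_replicate)
    qed
  qed
  then have "num_blocks (a # \<alpha>) (r # \<beta>) = card ?S"
    unfolding num_blocks_def by (rule bij_betw_same_card)
  also have "\<dots> = (\<Sum>(g, d)\<in>splits \<beta> (a - r). num_blocks \<alpha> d)"
    by (subst card_SigmaI) (auto simp: finite_splits finite_blocks num_blocks_def case_prod_unfold)
  finally show ?thesis using True by simp
qed

text \<open>A zero part is an empty block, which leaves the concatenated word alone. This mirrors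
  the removal of zero exponents for quasisymmetric coefficients.\<close>

lemma num_blocks_filter: "num_blocks \<alpha> \<beta> = num_blocks \<alpha> (filter (\<lambda>x. x \<noteq> 0) \<beta>)"
proof -
  have insert_zero: "num_blocks \<alpha> (us @ 0 # xs) = num_blocks \<alpha> (us @ xs)" for us xs
  proof -
    have "bij_betw (\<lambda>bs. take (length us) bs @ [] # drop (length us) bs)
        (blocks \<alpha> (us @ xs)) (blocks \<alpha> (us @ 0 # xs))"
    proof (rule bij_betw_byWitness[where f' = "\<lambda>bs. take (length us) bs @ drop (Suc (length us)) bs"])
      let ?k = "length us"
      show "\<forall>bs\<in>blocks \<alpha> (us @ xs). take ?k (take ?k bs @ [] # drop ?k bs)
          @ drop (Suc ?k) (take ?k bs @ [] # drop ?k bs) = bs"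
        by (auto simp: blocks_def dest!: arg_cong[of _ _ length])
      have split: "\<exists>cs ds. bs = cs @ [] # ds \<and> length cs = ?k \<and> map length cs = us \<and> map length ds = xs"
        if "bs \<in> blocks \<alpha> (us @ 0 # xs)" for bs
      proof -
        have "map length bs = us @ 0 # xs"
          using that by (simp add: blocks_def)
        then obtain cs ds' where cs: "bs = cs @ ds'" "map length cs = us" "map length ds' = 0 # xs"
          by (auto simp: map_eq_append_conv)
        then obtain ds where "ds' = [] # ds" "map length ds = xs"
          by (auto simp: map_eq_Cons_conv)
        then show ?thesis
          using cs by (metis length_map)
      qed
      show "\<forall>bs\<in>blocks \<alpha> (us @ 0 # xs). take ?k (take ?k bs @ drop (Suc ?k) bs)
          @ [] # drop ?k (take ?k bs @ drop (Suc ?k) bs) = bs"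
        using split by fastforce
      show "(\<lambda>bs. take ?k bs @ [] # drop ?k bs) ` blocks \<alpha> (us @ xs) \<subseteq> blocks \<alpha> (us @ 0 # xs)"
      proof (rule image_subsetI)
        fix bs
        assume bs: "bs \<in> blocks \<alpha> (us @ xs)"
        have "map length (take ?k bs) = us" "map length (drop ?k bs) = xs"
          using bs by (simp_all add: blocks_def flip: take_map drop_map)
        moreover have "concat (take ?k bs) @ concat (drop ?k bs) = concat bs"
          by (simp flip: concat_append)
        ultimately show "take ?k bs @ [] # drop ?k bs \<in> blocks \<alpha> (us @ 0 # xs)"
          using bs in_set_takeD[of _ ?k bs] in_set_dropD[of _ ?k bs] by (auto simp: blocks_def)
      qed
      show "(\<lambda>bs. take ?k bs @ drop (Suc ?k) bs) ` blocks \<alpha> (us @ 0 # xs) \<subseteq> blocks \<alpha> (us @ xs)"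
      proof (rule image_subsetI)
        fix bs
        assume bs: "bs \<in> blocks \<alpha> (us @ 0 # xs)"
        from split[OF bs] obtain cs ds where cs: "bs = cs @ [] # ds" "length cs = ?k"
          "map length cs = us" "map length ds = xs"
          by blast
        then have "take ?k bs @ drop (Suc ?k) bs = cs @ ds"
          by simp
        then show "take ?k bs @ drop (Suc ?k) bs \<in> blocks \<alpha> (us @ xs)"
          using bs cs by (simp add: blocks_def ball_Un)
      qed
    qed
    then show ?thesis
      by (simp add: num_blocks_def bij_betw_same_card)
  qed
  have "num_blocks \<alpha> (us @ \<beta>) = num_blocks \<alpha> (us @ filter (\<lambda>x. x \<noteq> 0) \<beta>)" for us
  proof (induction \<beta> arbitrary: us)
    case (Cons x \<beta>)
    then show ?case
      using Cons[of "us @ [x]"] by (simp add: insert_zero)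
  qed simp
  from this[of "[]"] show ?thesis by simp
qed

lemma map2_add_sum_zero:
  fixes g d :: "nat list"
  assumes "length g = length d" "sum_list g = 0"
  shows "map2 (+) g d = d"
  using assms by (induction g d rule: list_induct2) auto

text \<open>The recursion gives \<open>r \<le> a\<close>. If \<open>r < a\<close>, the comparison is
  decided; if \<open>r = a\<close>, the list \<open>g\<close> of a split has sum 0, so
  \<open>d\<close> is the tail of \<open>\<beta>\<close> and the induction continues.\<close>

lemma lex_of_num_blocks:
  assumes "num_blocks \<alpha> \<beta> > 0" "0 \<notin> set \<alpha>" "0 \<notin> set \<beta>"
  shows "lexordp_eq \<beta> \<alpha>"
  using assms
proof (induction \<alpha> arbitrary: \<beta>)
  case Nil
  then obtain bs where "bs \<in> blocks [] \<beta>"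
    by (auto simp: num_blocks_def card_gt_0_iff)
  then have "\<beta> = []"
    using Nil.prems(3) by (cases bs) (auto simp: blocks_def)
  then show ?case by simp
next
  case (Cons a \<alpha>)
  show ?case
  proof (cases \<beta>)
    case (Cons r \<beta>')
    have pos: "a > 0" "r > 0"
      using Cons.prems Cons by auto
    note eq = num_blocks_Cons[OF this, of \<alpha> \<beta>']
    show ?thesis
    proof (cases "r < a")
      case False
      then have "r = a"
        using eq Cons.prems(1) Cons by (auto split: if_splits)
      then have "(\<Sum>(g, d)\<in>splits \<beta>' 0. num_blocks \<alpha> d) > 0"
        using eq Cons.prems(1) Cons by simp
      then have "(\<Sum>(g, d)\<in>splits \<beta>' 0. num_blocks \<alpha> d) \<noteq> 0"
        by linarith
      then obtain p where "p \<in> splits \<beta>' 0" "(case p of (g, d) \<Rightarrow> num_blocks \<alpha> d) \<noteq> 0"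
        by (rule sum.not_neutral_contains_not_neutral)
      then obtain g d where gd: "(g, d) \<in> splits \<beta>' 0" "num_blocks \<alpha> d > 0"
        by (cases p) auto
      then have "map2 (+) g d = d"
        by (intro map2_add_sum_zero) (simp_all add: splits_def)
      then have "num_blocks \<alpha> \<beta>' > 0"
        using gd by (simp add: splits_def)
      then show ?thesis
        using Cons.IH[of \<beta>'] Cons.prems Cons \<open>r = a\<close> by simp
    qed (use Cons in simp)
  qed simp
qed


section \<open>Tableaux as words\<close>

text \<open>The word of a tableau lists the row indices of the entries 1, 2, ...; \<open>rows\<close> recovers the
  tableau from its word.\<close>

definition rows :: "nat \<Rightarrow> nat list \<Rightarrow> nat list list" where
  "rows m w = map (\<lambda>j. map Suc (filter (\<lambda>i. w ! i = j) [0..<length w])) [0..<m]"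

lemma length_rows [simp]: "length (rows m w) = m"
  by (simp add: rows_def)

lemma set_rows_nth: "j < m \<Longrightarrow> set (rows m w ! j) = {Suc i | i. i < length w \<and> w ! i = j}"
  by (auto simp: rows_def)

lemma sorted_rows_nth: "j < m \<Longrightarrow> sorted_wrt (<) (rows m w ! j)"
  by (simp add: rows_def sorted_wrt_map sorted_wrt_filter)

lemma length_rows_nth: "j < m \<Longrightarrow> length (rows m w ! j) = count_list w j"
proof -
  assume "j < m"
  have "length (filter (\<lambda>i. w ! i = j) [0..<length w]) = count_list w j"
  proof (induction w rule: rev_induct)
    case (snoc x w)
    have "filter (\<lambda>i. (w @ [x]) ! i = j) [0..<length w] = filter (\<lambda>i. w ! i = j) [0..<length w]"
      by (rule filter_cong) (auto simp: nth_append)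
    then show ?case using snoc by simp
  qed simp
  then show ?thesis
    using \<open>j < m\<close> by (simp add: rows_def)
qed

lemma distinct_concat_iff_nth:
  "distinct (concat T) \<longleftrightarrow> (\<forall>row\<in>set T. distinct row) \<and>
     (\<forall>j k. j < k \<longrightarrow> k < length T \<longrightarrow> set (T ! j) \<inter> set (T ! k) = {})"
proof (induction T)
  case (Cons r T)
  have "(\<forall>j k. j < k \<longrightarrow> k < length (r # T) \<longrightarrow> set ((r # T) ! j) \<inter> set ((r # T) ! k) = {})
      \<longleftrightarrow> (\<forall>k<length T. set r \<inter> set (T ! k) = {}) \<and>
        (\<forall>j k. j < k \<longrightarrow> k < length T \<longrightarrow> set (T ! j) \<inter> set (T ! k) = {})" (is "?L \<longleftrightarrow> ?R")
  proof
    assume L: ?L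
    show ?R
      using L[rule_format, of 0 "Suc _"] L[rule_format, of "Suc _" "Suc _"] by simp
  next
    assume R: ?R
    show ?L
    proof (intro allI impI)
      fix j k
      assume "j < k" "k < length (r # T)"
      then show "set ((r # T) ! j) \<inter> set ((r # T) ! k) = {}"
        using R by (cases j; cases k) auto
    qed
  qed
  moreover have "set r \<inter> set (concat T) = {} \<longleftrightarrow> (\<forall>k<length T. set r \<inter> set (T ! k) = {})"
    by (simp add: set_concat disjoint_iff all_set_conv_all_nth) blast
  ultimately show ?case
    using Cons.IH by (simp del: set_concat) blast
qed simp

lemma distinct_concat_rows: "distinct (concat (rows m w))"
  unfolding distinct_concat_iff_nth
proof (intro conjI ballI allI impI)
  fix row
  assume "row \<in> set (rows m w)"
  then show "distinct row"
    by (auto simp: rows_def distinct_map)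
next
  fix j k
  assume "j < k" "k < length (rows m w)"
  then show "set (rows m w ! j) \<inter> set (rows m w ! k) = {}"
    by (auto simp: set_rows_nth)
qed

lemma set_concat_rows:
  assumes "set w \<subseteq> {..<m}"
  shows "set (concat (rows m w)) = {1..length w}"
proof (intro set_eqI iffI)
  fix x
  assume "x \<in> {1..length w}"
  then have "x - 1 < length w" "x = Suc (x - 1)" by auto
  moreover from this have "w ! (x - 1) < m" using assms nth_mem by blast
  ultimately show "x \<in> set (concat (rows m w))"
    by (auto simp: rows_def image_iff)
qed (auto simp: rows_def)

text \<open>The head of row \<open>j\<close> is one more than the position \<open>p j\<close> of the
  first letter \<open>j\<close>, so both sides say that these positions increase. Each letter must
  occur for the heads to be meaningful.\<close>

lemma sorted_heads_rows:
  assumes "\<And>j. j < m \<Longrightarrow> j \<in> set w" "set w \<subseteq> {..<m}"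
  shows "sorted_wrt (<) (map hd (rows m w)) \<longleftrightarrow> ordered_first w"
proof -
  define p where "p j = hd (filter (\<lambda>i. w ! i = j) [0..<length w])" for j
  have hd_rows: "hd (rows m w ! j) = Suc (p j)" and p: "p j < length w" "w ! p j = j"
    and p_le: "\<And>i. i < length w \<Longrightarrow> w ! i = j \<Longrightarrow> p j \<le> i" if j: "j < m" for j
  proof -
    let ?l = "filter (\<lambda>i. w ! i = j) [0..<length w]"
    obtain i0 where "i0 < length w" "w ! i0 = j"
      using assms(1)[OF j] by (auto simp: in_set_conv_nth)
    then have "i0 \<in> set ?l" by simp
    then have ne: "?l \<noteq> []" by (metis empty_iff empty_set)
    then show "hd (rows m w ! j) = Suc (p j)"
      using j by (simp add: rows_def p_def hd_map)
    have "p j \<in> set ?l" unfolding p_def using ne by (rule hd_in_set)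
    then show "p j < length w" "w ! p j = j" by auto
    fix i
    assume "i < length w" "w ! i = j"
    then have "i \<in> set ?l" by simp
    moreover have "sorted ?l" by (simp add: sorted_wrt_filter)
    ultimately show "p j \<le> i"
      unfolding p_def using ne by (cases ?l) auto
  qed
  have "sorted_wrt (<) (map hd (rows m w)) \<longleftrightarrow> (\<forall>j k. j < k \<longrightarrow> k < m \<longrightarrow> p j < p k)"
    using hd_rows by (simp add: sorted_wrt_iff_nth_less)
  also have "\<dots> \<longleftrightarrow> ordered_first w"
  proof
    assume sorted: "\<forall>j k. j < k \<longrightarrow> k < m \<longrightarrow> p j < p k"
    show "ordered_first w"
      unfolding ordered_first_def
    proof (intro allI impI subsetI)
      fix i j
      assume i: "i < length w" and "j \<in> {..<w ! i}"
      then have j: "j < w ! i" by simp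
      have "w ! i < m" using i assms(2) nth_mem by blast
      then have "p j < p (w ! i)" "p (w ! i) \<le> i"
        using sorted j p_le i by auto
      then have "p j < i" by simp
      then show "j \<in> set (take i w)"
        using p[of j] j \<open>w ! i < m\<close> i by (metis in_set_conv_nth length_take less_trans min_less_iff_conj nth_take)
    qed
  next
    assume ord: "ordered_first w"
    show "\<forall>j k. j < k \<longrightarrow> k < m \<longrightarrow> p j < p k"
    proof (intro allI impI)
      fix j k
      assume "j < k" "k < m"
      have "{..<w ! p k} \<subseteq> set (take (p k) w)"
        using ord p(1)[OF \<open>k < m\<close>] unfolding ordered_first_def by blast
      then have "j \<in> set (take (p k) w)"
        using \<open>j < k\<close> p(2)[OF \<open>k < m\<close>] by auto
      then obtain i where "i < p k" "i < length w" "w ! i = j"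
        by (auto simp: in_set_conv_nth)
      then show "p j < p k"
        using p_le[of j i] \<open>j < k\<close> \<open>k < m\<close> by simp
    qed
  qed
  finally show ?thesis .
qed

lemma standard_immaculate_tableau_rows:
  assumes "length w = comp_size \<alpha>" "set w \<subseteq> {..<length (parts \<alpha>)}"
  shows "standard_immaculate_tableau \<alpha> (rows (length (parts \<alpha>)) w) \<longleftrightarrow> immaculate_word (parts \<alpha>) w"
proof -
  let ?m = "length (parts \<alpha>)"
  let ?T = "rows ?m w"
  have lengths: "map length ?T = parts \<alpha> \<longleftrightarrow> (\<forall>j<?m. count_list w j = parts \<alpha> ! j)"
    by (simp add: list_eq_iff_nth_eq length_rows_nth)
  have sorted: "\<forall>row\<in>set ?T. sorted_wrt (<) row"
    using sorted_rows_nth[of _ ?m w] by (auto simp: in_set_conv_nth)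
  \<comment> \<open>Claimed only under the right row lengths: these are positive, so no row is empty
    and every \<open>hd\<close> is a genuine entry.\<close>
  have "sorted_wrt (<) (map hd ?T) \<longleftrightarrow> ordered_first w"
    if counts: "\<forall>j<?m. count_list w j = parts \<alpha> ! j"
  proof (rule sorted_heads_rows[OF _ assms(2)])
    fix j
    assume "j < ?m"
    then have "parts \<alpha> ! j \<noteq> 0"
      using parts[of \<alpha>] by (metis (mono_tags) mem_Collect_eq nth_mem)
    then show "j \<in> set w"
      using counts \<open>j < ?m\<close> by (metis count_list_0_iff)
  qed
  then show ?thesis
    unfolding standard_immaculate_tableau_def immaculate_word_def lengths
    using sorted assms set_concat_rows[OF assms(2)] distinct_concat_rows[of ?m w] by metis
qed

lemma standard_immaculate_tableau_obtain_word:
  assumes T: "standard_immaculate_tableau \<alpha> T"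
  obtains w where "length w = comp_size \<alpha>" "set w \<subseteq> {..<length (parts \<alpha>)}"
    "T = rows (length (parts \<alpha>)) w"
proof
  let ?n = "comp_size \<alpha>"
  let ?m = "length (parts \<alpha>)"
  \<comment> \<open>The row containing the entry \<open>i + 1\<close>: positions in words start at
    0, entries at 1.\<close>
  define r where "r i = (SOME j. j < ?m \<and> Suc i \<in> set (T ! j))" for i
  let ?w = "map r [0..<?n]"
  have m: "length T = ?m" and n: "set (concat T) = {1..?n}" and d: "distinct (concat T)"
    and s: "\<And>row. row \<in> set T \<Longrightarrow> sorted_wrt (<) row"
    using T by (auto simp: standard_immaculate_tableau_def dest: arg_cong[of _ _ length])
  have r: "r i < ?m" "Suc i \<in> set (T ! r i)" if "i < ?n" for i
  proof -
    have "Suc i \<in> set (concat T)" using n that by simp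
    then obtain row where "row \<in> set T" "Suc i \<in> set row" by auto
    then have "\<exists>j. j < ?m \<and> Suc i \<in> set (T ! j)"
      by (metis in_set_conv_nth m)
    from someI_ex[OF this] show "r i < ?m" "Suc i \<in> set (T ! r i)"
      unfolding r_def by auto
  qed
  have disj: "set (T ! j) \<inter> set (T ! k) = {}" if "j < ?m" "k < ?m" "j \<noteq> k" for j k
    using d that m unfolding distinct_concat_iff_nth by (metis Int_commute linorder_neqE_nat)
  show "length ?w = ?n" "set ?w \<subseteq> {..<?m}"
    using r by auto
  show "T = rows ?m ?w"
  proof (rule nth_equalityI)
    fix j
    assume "j < length T"
    then have j: "j < ?m" using m by simp
    have "set (T ! j) = {Suc i | i. i < ?n \<and> r i = j}"
    proof (intro set_eqI iffI)
      fix x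
      assume x: "x \<in> set (T ! j)"
      then have "x \<in> set (concat T)" using j m by auto
      then have "x \<in> {1..?n}" by (simp only: n)
      then have "x - 1 < ?n" "x = Suc (x - 1)" by auto
      moreover from this have "r (x - 1) = j"
        using r[of "x - 1"] disj[OF _ j, of "r (x - 1)"] x by auto
      ultimately show "x \<in> {Suc i | i. i < ?n \<and> r i = j}" by blast
    qed (use r in auto)
    then have "set (T ! j) = set (rows ?m ?w ! j)"
      using j by (auto simp: set_rows_nth)
    then show "T ! j = rows ?m ?w ! j"
      using s[of "T ! j"] sorted_rows_nth[OF j, of ?w] j m by (intro strict_sorted_equal) auto
  qed (simp add: m)
qed

lemma rows_inject:
  assumes "rows m v = rows m w" "length v = length w" "set v \<subseteq> {..<m}" "set w \<subseteq> {..<m}"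
  shows "v = w"
proof (rule nth_equalityI)
  fix i
  assume i: "i < length v"
  then have "v ! i < m" using assms(3) nth_mem by blast
  moreover have "Suc i \<in> set (rows m v ! (v ! i))"
    using i \<open>v ! i < m\<close> by (auto simp: set_rows_nth)
  ultimately show "v ! i = w ! i"
    using assms(1) by (auto simp: set_rows_nth)
qed (fact assms)

text \<open>The entries \<open>i\<close> and \<open>i + 1\<close> sit at positions
  \<open>i - 1\<close> and \<open>i\<close> of the word, so descents of the tableau are ascents of
  the word.\<close>

lemma descents_rows:
  assumes "set w \<subseteq> {..<m}"
  shows "descents (rows m w) = {i. 0 < i \<and> i < length w \<and> w ! (i - 1) < w ! i}"
proof (intro set_eqI iffI)
  fix i
  assume "i \<in> descents (rows m w)"
  then show "i \<in> {i. 0 < i \<and> i < length w \<and> w ! (i - 1) < w ! i}"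
    by (auto simp: descents_def set_rows_nth)
next
  fix i
  assume i: "i \<in> {i. 0 < i \<and> i < length w \<and> w ! (i - 1) < w ! i}"
  then have "w ! i < m" using assms nth_mem by blast
  moreover have "i \<in> set (rows m w ! (w ! (i - 1)))" "i + 1 \<in> set (rows m w ! (w ! i))"
    using i \<open>w ! i < m\<close> by (auto simp: set_rows_nth intro!: exI[of _ "i - 1"])
  ultimately show "i \<in> descents (rows m w)"
    using i by (auto simp: descents_def)
qed

text \<open>Inside a block no ascent may occur, while between blocks anything is allowed; the
  positions at which a new block starts are partial sums of the block lengths.\<close>

lemma weakly_decreasing_blocks_iff:
  "(\<forall>b\<in>set bs. sorted_wrt (\<ge>) b) \<longleftrightarrow>
     {i. 0 < i \<and> i < length (concat bs) \<and> concat bs ! (i - 1) < concat bs ! i}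
       \<subseteq> psums (map length bs)" for bs :: "nat list list"
proof (induction bs)
  case (Cons b bs)
  let ?D = "\<lambda>w. {i. 0 < i \<and> i < length w \<and> w ! (i - 1) < (w ! i :: nat)}"
  let ?l = "length b"
  have "sorted_wrt (\<ge>) b \<longleftrightarrow> (\<forall>i. 0 < i \<longrightarrow> i < ?l \<longrightarrow> b ! (i - 1) \<ge> b ! i)"
  proof -
    have "sorted_wrt (\<ge>) b \<longleftrightarrow> (\<forall>i. Suc i < ?l \<longrightarrow> b ! i \<ge> b ! Suc i)"
      by (rule sorted_wrt_iff_nth_Suc_transp) (auto simp: transp_def)
    also have "\<dots> \<longleftrightarrow> (\<forall>i. 0 < i \<longrightarrow> i < ?l \<longrightarrow> b ! (i - 1) \<ge> b ! i)"
      by (metis Suc_pred diff_Suc_1 zero_less_Suc)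
    finally show ?thesis .
  qed
  moreover have "?D (concat (b # bs)) \<subseteq> psums (map length (b # bs)) \<longleftrightarrow>
      (\<forall>i. 0 < i \<longrightarrow> i < ?l \<longrightarrow> b ! (i - 1) \<ge> b ! i) \<and> ?D (concat bs) \<subseteq> psums (map length bs)"
    (is "?L \<longleftrightarrow> ?R")
  proof
    assume L: ?L
    have "b ! (i - 1) \<ge> b ! i" if "0 < i" "i < ?l" for i
    proof (rule ccontr)
      assume "\<not> b ! (i - 1) \<ge> b ! i"
      then have "i \<in> ?D (concat (b # bs))"
        using that by (auto simp: nth_append)
      then have "i \<in> psums (map length (b # bs))" using L by blast
      then show False using that by auto
    qed
    moreover have "i \<in> psums (map length bs)" if "i \<in> ?D (concat bs)" for i
    proof -
      have "?l + i - 1 = ?l + (i - 1)" using that by auto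
      then have "?l + i \<in> ?D (concat (b # bs))"
        using that by (auto simp: nth_append)
      then have "?l + i \<in> psums (map length (b # bs))" using L by blast
      then show ?thesis using that by auto
    qed
    ultimately show ?R by blast
  next
    assume R: ?R
    show ?L
    proof
      fix i
      assume i: "i \<in> ?D (concat (b # bs))"
      consider "i < ?l" | "i = ?l" | "i > ?l" by linarith
      then show "i \<in> psums (map length (b # bs))"
      proof cases
        case 1
        moreover from this have "i - 1 < ?l" by linarith
        ultimately have "b ! (i - 1) < b ! i" using i by (simp add: nth_append)
        then have False
          using conjunct1[OF R, rule_format, of i] i 1 by simp
        then show ?thesis ..
      next
        \<comment> \<open>The boundary after \<open>b\<close>: \<open>?l\<close> is itself a partial
          sum, so an ascent here is harmless.\<close>
        case 2
        then show ?thesis using image_eqI[of i "(+) ?l" 0] by simp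
      next
        case 3
        moreover from this have "\<not> i - 1 < ?l" "i - ?l - 1 = i - 1 - ?l" by linarith+
        ultimately have "i - ?l \<in> ?D (concat bs)"
          using i by (auto simp: nth_append)
        then have "i - ?l \<in> psums (map length bs)" using R by blast
        then show ?thesis using image_eqI[of i "(+) ?l" "i - ?l"] 3 by simp
      qed
    qed
  qed
  ultimately show ?case
    using Cons.IH by (simp only: list.set ball_simps)
qed simp

lemma ex_blocks_concat:
  "length w = sum_list \<beta> \<Longrightarrow> \<exists>bs. concat bs = w \<and> map length bs = \<beta>"
proof (induction \<beta> arbitrary: w)
  case (Cons r \<beta>)
  then obtain bs where "concat bs = drop r w" "map length bs = \<beta>"
    by (metis add_diff_cancel_left' length_drop sum_list.Cons)
  then show ?case
    using Cons.prems by (intro exI[of _ "take r w # bs"]) auto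
qed simp

text \<open>Cut the word of a tableau into pieces of lengths \<open>parts \<delta>\<close>. The
  bound on the descents says that the cuts are made at every ascent, that is, that all pieces are
  weakly decreasing.\<close>

lemma card_tableaux:
  assumes "comp_size \<delta> = comp_size \<alpha>"
  shows "card {T. standard_immaculate_tableau \<alpha> T \<and> descents T \<subseteq> comp_set \<delta>}
    = num_blocks (parts \<alpha>) (parts \<delta>)"
proof -
  let ?m = "length (parts \<alpha>)"
  let ?B = "blocks (parts \<alpha>) (parts \<delta>)"
  have len: "length (concat bs) = comp_size \<alpha>" if "map length bs = parts \<delta>" for bs :: "nat list list"
    using that assms by (simp add: length_concat comp_size_def)
  have desc: "descents (rows ?m (concat bs)) \<subseteq> comp_set \<delta> \<longleftrightarrow> (\<forall>b\<in>set bs. sorted_wrt (\<ge>) b)"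
    if bs: "map length bs = parts \<delta>" "set (concat bs) \<subseteq> {..<?m}" for bs
  proof -
    \<comment> \<open>A descent is never 0 or the total size, and \<open>psums\<close> exceeds
      \<open>comp_set\<close> only by these two values.\<close>
    have "descents (rows ?m (concat bs)) \<subseteq> {0<..<comp_size \<delta>}"
      unfolding descents_rows[OF bs(2)] using len[OF bs(1)] assms by auto
    then have "descents (rows ?m (concat bs)) \<subseteq> comp_set \<delta>
        \<longleftrightarrow> descents (rows ?m (concat bs)) \<subseteq> psums (parts \<delta>)"
      unfolding comp_set_eq_psums by auto
    then show ?thesis
      unfolding descents_rows[OF bs(2)] weakly_decreasing_blocks_iff bs(1) .
  qed
  have "bij_betw (\<lambda>bs. rows ?m (concat bs)) ?B
      {T. standard_immaculate_tableau \<alpha> T \<and> descents T \<subseteq> comp_set \<delta>}"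
  proof (rule bij_betw_imageI)
    show "inj_on (\<lambda>bs. rows ?m (concat bs)) ?B"
    proof (rule inj_onI)
      fix bs cs
      assume bs: "bs \<in> ?B" and cs: "cs \<in> ?B" and eq: "rows ?m (concat bs) = rows ?m (concat cs)"
      have l: "map length bs = parts \<delta>" "map length cs = parts \<delta>"
        "set (concat bs) \<subseteq> {..<?m}" "set (concat cs) \<subseteq> {..<?m}"
        using bs cs by (simp_all add: blocks_def immaculate_word_def)
      have "concat bs = concat cs"
        by (rule rows_inject[OF eq _ l(3,4)]) (simp only: len[OF l(1)] len[OF l(2)])
      moreover have "length bs = length cs"
        using l by (metis length_map)
      moreover have "\<forall>(x, y)\<in>set (zip bs cs). length x = length y"
        using l by (auto simp: set_zip list_eq_iff_nth_eq)
      ultimately show "bs = cs"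
        by (rule concat_injective)
    qed
    show "(\<lambda>bs. rows ?m (concat bs)) ` ?B
        = {T. standard_immaculate_tableau \<alpha> T \<and> descents T \<subseteq> comp_set \<delta>}"
    proof (intro equalityI subsetI)
      fix T
      assume "T \<in> (\<lambda>bs. rows ?m (concat bs)) ` ?B"
      then obtain bs where T: "T = rows ?m (concat bs)" and bs: "bs \<in> ?B" by blast
      have l: "map length bs = parts \<delta>" "set (concat bs) \<subseteq> {..<?m}"
        "\<forall>b\<in>set bs. sorted_wrt (\<ge>) b" "immaculate_word (parts \<alpha>) (concat bs)"
        using bs by (simp_all add: blocks_def immaculate_word_def)
      then show "T \<in> {T. standard_immaculate_tableau \<alpha> T \<and> descents T \<subseteq> comp_set \<delta>}"
        using standard_immaculate_tableau_rows[OF len[OF l(1)] l(2)] desc[OF l(1,2)] T by simp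
    next
      fix T
      assume "T \<in> {T. standard_immaculate_tableau \<alpha> T \<and> descents T \<subseteq> comp_set \<delta>}"
      then have T: "standard_immaculate_tableau \<alpha> T" "descents T \<subseteq> comp_set \<delta>" by auto
      obtain w where w: "length w = comp_size \<alpha>" "set w \<subseteq> {..<?m}" "T = rows ?m w"
        using T(1) by (rule standard_immaculate_tableau_obtain_word)
      have "length w = sum_list (parts \<delta>)"
        using w(1) assms by (simp add: comp_size_def)
      from ex_blocks_concat[OF this] obtain bs where bs: "concat bs = w" "map length bs = parts \<delta>"
        by blast
      have "immaculate_word (parts \<alpha>) w"
        using standard_immaculate_tableau_rows[OF w(1,2)] T(1) w(3) by simp
      moreover have "\<forall>b\<in>set bs. sorted_wrt (\<ge>) b"
        using desc[OF bs(2)] w T(2) bs(1) by simp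
      ultimately have "bs \<in> ?B"
        using bs by (simp add: blocks_def)
      then show "T \<in> (\<lambda>bs. rows ?m (concat bs)) ` ?B"
        using w(3) bs(1) by blast
    qed
  qed
  then show ?thesis
    unfolding num_blocks_def by (rule bij_betw_same_card[symmetric])
qed


section \<open>The fundamental expansion\<close>

lemma finite_comp_le: "finite {\<gamma>. comp_le \<gamma> \<beta>}"
  by (rule finite_subset[OF _ finite_compositions[of "comp_size \<beta>"]]) (auto simp: comp_le_def)

lemma quasisymmetric_qsym_F: "quasisymmetric (qsym_F \<beta>)"
  unfolding qsym_F_def by (intro quasisymmetric_sum quasisymmetric_qsym_M)

lemma homogeneous_qsym_F: "homogeneous (comp_size \<beta>) (qsym_F \<beta>)"
  using homogeneous_qsym_M
  by (auto simp: qsym_F_def homogeneous_def coeff_sum comp_le_def intro!: sum.neutral)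

lemma coeff_qsym_F: "coeff (qsym_F \<beta>) (mono_of (parts \<delta>)) = (if comp_le \<delta> \<beta> then 1 else 0)"
  by (simp add: qsym_F_def coeff_sum coeff_qsym_M_mono_of finite_comp_le)

section \<open>Descent compositions of standard immaculate tableaux\<close>

lemma descents_subset:
  assumes "standard_immaculate_tableau \<alpha> T"
  shows "descents T \<subseteq> {0<..<comp_size \<alpha>}"
proof
  fix i
  assume "i \<in> descents T"
  then obtain j k where jk: "j < k" "k < length T" "i \<in> set (T ! j)" "i + 1 \<in> set (T ! k)"
    by (auto simp: descents_def)
  then have "T ! j \<in> set T" "T ! k \<in> set T" by simp_all
  with jk(3,4) have "i \<in> set (concat T)" "i + 1 \<in> set (concat T)"
    unfolding set_concat by blast+
  moreover have "set (concat T) = {1..comp_size \<alpha>}"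
    using assms unfolding standard_immaculate_tableau_def by blast
  ultimately show "i \<in> {0<..<comp_size \<alpha>}"
    by (simp del: set_concat)
qed

lemma descent_composition:
  assumes "standard_immaculate_tableau \<alpha> T"
  shows "comp_size (descent_composition T) = comp_size \<alpha>"
    and "comp_set (descent_composition T) = descents T"
proof -
  have "distinct (concat T)" "set (concat T) = {1..comp_size \<alpha>}"
    using assms unfolding standard_immaculate_tableau_def by blast+
  then have len: "length (concat T) = comp_size \<alpha>"
    by (metis card_atLeastAtMost diff_Suc_1 distinct_card)
  have "\<exists>!\<beta>. comp_size \<beta> = length (concat T) \<and> comp_set \<beta> = descents T"
    using ex_comp_set[OF descents_subset[OF assms]] comp_set_inject unfolding len by metis
  from theI'[OF this, folded descent_composition_def]
  show "comp_size (descent_composition T) = comp_size \<alpha>"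
    and "comp_set (descent_composition T) = descents T"
    by (simp_all only: len)
qed

lemma finite_standard_immaculate_tableaux: "finite {T. standard_immaculate_tableau \<alpha> T}"
proof -
  let ?n = "comp_size \<alpha>"
  have "{T. standard_immaculate_tableau \<alpha> T} \<subseteq>
      {T. set T \<subseteq> {row. set row \<subseteq> {..?n} \<and> length row \<le> ?n} \<and> length T = length (parts \<alpha>)}"
  proof
    fix T
    assume "T \<in> {T. standard_immaculate_tableau \<alpha> T}"
    then have T: "map length T = parts \<alpha>" "set (concat T) = {1..?n}"
      unfolding standard_immaculate_tableau_def by blast+
    have "set row \<subseteq> {..?n} \<and> length row \<le> ?n" if row: "row \<in> set T" for row
    proof
      have "set row \<subseteq> {1..?n}" unfolding T(2)[symmetric] using row by auto
      then show "set row \<subseteq> {..?n}" by auto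
      have "length row \<in> set (parts \<alpha>)" unfolding T(1)[symmetric] using row by auto
      then show "length row \<le> ?n" unfolding comp_size_def by (rule member_le_sum_list) simp
    qed
    moreover have "length T = length (parts \<alpha>)"
      using T(1) by (metis length_map)
    ultimately show "T \<in> {T. set T \<subseteq> {row. set row \<subseteq> {..?n} \<and> length row \<le> ?n} \<and>
        length T = length (parts \<alpha>)}"
      by blast
  qed
  then show ?thesis
    by (rule finite_subset) (intro finite_lists_length_eq finite_lists_length_le finite_atMost)
qed

text \<open>The series \<open>G\<^sub>\<alpha>\<close> of the overview.\<close>

definition fundamental_sum :: "composition \<Rightarrow> pseries" where
  "fundamental_sum \<alpha> = (\<Sum>\<beta> | comp_size \<beta> = comp_size \<alpha> \<and> lex_le \<beta> \<alpha>.
     pscale (of_nat (L_coeff \<alpha> \<beta>)) (qsym_F \<beta>))"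

lemma finite_lex_le: "finite {\<beta>. comp_size \<beta> = n \<and> lex_le \<beta> \<alpha>}"
  by (rule finite_subset[OF _ finite_compositions[of n]]) auto

lemma quasisymmetric_fundamental_sum: "quasisymmetric (fundamental_sum \<alpha>)"
  unfolding fundamental_sum_def
  by (intro quasisymmetric_sum quasisymmetric_pscale quasisymmetric_qsym_F)

lemma homogeneous_fundamental_sum: "homogeneous (comp_size \<alpha>) (fundamental_sum \<alpha>)"
  using homogeneous_qsym_F
  by (auto simp: fundamental_sum_def homogeneous_def coeff_sum_pscale intro!: sum.neutral)

lemma fundamental_sum_in_QSym_deg: "fundamental_sum \<alpha> \<in> QSym_deg (comp_size \<alpha>)"
  by (intro quasisymmetric_homogeneous_in_QSym_deg quasisymmetric_fundamental_sum
      homogeneous_fundamental_sum)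

lemma fundamental_sum_in_QSym: "fundamental_sum \<alpha> \<in> QSym"
  using fundamental_sum_in_QSym_deg QSym_deg_subset by blast

text \<open>A tableau with descent composition \<open>\<beta>\<close> is among those counted by
  \<open>num_blocks (parts \<alpha>) (parts \<beta>)\<close>, and a positive block count implies the
  lexicographic bound.\<close>

lemma L_coeff_lex:
  assumes "L_coeff \<alpha> \<beta> \<noteq> 0"
  shows "lex_le \<beta> \<alpha>"
proof -
  obtain T where T: "standard_immaculate_tableau \<alpha> T" "descent_composition T = \<beta>"
    using assms unfolding L_coeff_def by (metis (mono_tags, lifting) card.empty empty_Collect_eq)
  then have \<beta>: "comp_size \<beta> = comp_size \<alpha>" "comp_set \<beta> = descents T"
    using descent_composition by auto
  let ?S = "{T. standard_immaculate_tableau \<alpha> T \<and> descents T \<subseteq> comp_set \<beta>}"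
  have "T \<in> ?S" using T \<beta> by simp
  moreover have "finite ?S"
    by (rule finite_subset[OF _ finite_standard_immaculate_tableaux]) auto
  ultimately have "card ?S > 0" by (metis card_gt_0_iff empty_iff)
  then have "num_blocks (parts \<alpha>) (parts \<beta>) > 0"
    using card_tableaux[OF \<beta>(1)] by simp
  then show ?thesis
    unfolding lex_le_def using parts[of \<alpha>] parts[of \<beta>] by (intro lex_of_num_blocks) simp_all
qed

lemma blocks_sum:
  assumes "bs \<in> blocks \<alpha> \<beta>"
  shows "sum_list \<alpha> = sum_list \<beta>"
proof -
  have imm: "set (concat bs) \<subseteq> {..<length \<alpha>}" "\<forall>j<length \<alpha>. count_list (concat bs) j = \<alpha> ! j"
    and l: "map length bs = \<beta>"
    using assms by (simp_all add: blocks_def immaculate_word_def)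
  have "sum_list \<alpha> = (\<Sum>j<length \<alpha>. \<alpha> ! j)"
    by (simp add: sum_list_sum_nth atLeast0LessThan)
  also have "\<dots> = (\<Sum>j<length \<alpha>. count_list (concat bs) j)"
    using imm by simp
  also have "\<dots> = (\<Sum>j\<in>set (concat bs). count_list (concat bs) j)"
    by (rule sum.mono_neutral_right) (use imm in \<open>auto simp: count_list_0_iff simp del: set_concat\<close>)
  also have "\<dots> = length (concat bs)"
    by (rule sum_count_set) auto
  also have "\<dots> = sum_list \<beta>"
    by (simp add: length_concat l)
  finally show ?thesis .
qed

lemma coeff_fundamental_sum_parts:
  "coeff (fundamental_sum \<alpha>) (mono_of (parts \<delta>)) = of_nat (num_blocks (parts \<alpha>) (parts \<delta>))"
proof (cases "comp_size \<delta> = comp_size \<alpha>")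
  case False
  then have "blocks (parts \<alpha>) (parts \<delta>) = {}"
    using blocks_sum unfolding comp_size_def by fastforce
  then show ?thesis
    using False homogeneous_fundamental_sum[of \<alpha>]
    by (simp add: num_blocks_def homogeneous_def comp_size_def)
next
  case True
  let ?n = "comp_size \<alpha>"
  let ?S = "{T. standard_immaculate_tableau \<alpha> T \<and> descents T \<subseteq> comp_set \<delta>}"
  let ?B = "{\<beta>. comp_size \<beta> = ?n \<and> comp_le \<delta> \<beta>}"
  have finS: "finite ?S"
    by (rule finite_subset[OF _ finite_standard_immaculate_tableaux]) auto
  have finB: "finite ?B"
    by (rule finite_subset[OF _ finite_compositions[of ?n]]) auto
  have "coeff (fundamental_sum \<alpha>) (mono_of (parts \<delta>))
      = (\<Sum>\<beta> | comp_size \<beta> = ?n \<and> lex_le \<beta> \<alpha>. if comp_le \<delta> \<beta> then of_nat (L_coeff \<alpha> \<beta>) else 0)"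
    by (simp add: fundamental_sum_def coeff_sum_pscale coeff_qsym_F if_distrib cong: if_cong)
  \<comment> \<open>Dropping the lexicographic restriction adds only zero terms.\<close>
  also have "\<dots> = (\<Sum>\<beta> | comp_size \<beta> = ?n. if comp_le \<delta> \<beta> then of_nat (L_coeff \<alpha> \<beta>) else 0)"
    by (rule sum.mono_neutral_left[OF finite_compositions]) (use L_coeff_lex in auto)
  also have "\<dots> = (\<Sum>\<beta>\<in>?B. of_nat (L_coeff \<alpha> \<beta>))"
    by (rule sum.mono_neutral_cong_right[OF finite_compositions]) auto
  \<comment> \<open>Double counting: the tableaux with descents inside
    \<open>comp_set \<delta>\<close> are sorted by their descent composition, which then ranges over
    the compositions that \<open>\<delta>\<close> refines.\<close>
  also have "\<dots> = (\<Sum>\<beta>\<in>?B. \<Sum>T\<in>{T \<in> ?S. descent_composition T = \<beta>}. 1)"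
  proof (rule sum.cong[OF refl])
    fix \<beta>
    assume "\<beta> \<in> ?B"
    then have "{T. standard_immaculate_tableau \<alpha> T \<and> descent_composition T = \<beta>}
        = {T \<in> ?S. descent_composition T = \<beta>}"
      using descent_composition by (auto simp: comp_le_def)
    then show "of_nat (L_coeff \<alpha> \<beta>) = (\<Sum>T\<in>{T \<in> ?S. descent_composition T = \<beta>}. 1 :: rat)"
      by (simp add: L_coeff_def)
  qed
  also have "\<dots> = (\<Sum>T\<in>?S. 1)"
    by (rule sum.group[OF finS finB]) (use True descent_composition in \<open>auto simp: comp_le_def\<close>)
  also have "\<dots> = of_nat (num_blocks (parts \<alpha>) (parts \<delta>))"
    by (simp add: card_tableaux[OF True])
  finally show ?thesis .
qed

text \<open>Both sides ignore zero entries. The extension to arbitrary lists is needed for the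
  factors of a gap-free monomial in a product with \<open>sym_h\<close>.\<close>

lemma coeff_fundamental_sum:
  "coeff (fundamental_sum \<alpha>) (mono_of xs) = of_nat (num_blocks (parts \<alpha>) xs)"
proof -
  let ?\<delta> = "Abs_composition (filter (\<lambda>x. x \<noteq> 0) xs)"
  have "parts ?\<delta> = filter (\<lambda>x. x \<noteq> 0) xs"
    by (simp add: Abs_composition_inverse)
  then show ?thesis
    using coeff_fundamental_sum_parts[of \<alpha> ?\<delta>] num_blocks_filter[of "parts \<alpha>" xs]
      quasisymmetric_mono_of_filter[OF quasisymmetric_fundamental_sum, of \<alpha> xs] by simp
qed

section \<open>Stripping rules and duality for the fundamental sums\<close>

lemma strip_first_fundamental_sum_Nil:
  assumes "r > 0"
  shows "strip_first r (fundamental_sum 0) = 0"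
proof (rule quasisymmetric_eqI)
  fix \<beta>
  have "blocks [] (r # parts \<beta>) = {}"
    using assms by (auto simp: blocks_def)
  then show "coeff (strip_first r (fundamental_sum 0)) (mono_of (parts \<beta>)) = coeff 0 (mono_of (parts \<beta>))"
    by (simp add: coeff_strip_first_mono_of coeff_fundamental_sum zero_composition.rep_eq
        num_blocks_def zero_pseries.rep_eq)
qed (intro quasisymmetric_strip_first quasisymmetric_fundamental_sum quasisymmetric_zero)+

text \<open>At a gap-free monomial, \<open>num_blocks_Cons\<close> is the product rule for
  \<open>sym_h (a - r)\<close>: every coefficient of the latter in degree \<open>a - r\<close> is 1,
  and \<open>splits\<close> lists the factorisations.\<close>

lemma strip_first_fundamental_sum_Cons:
  assumes "parts \<alpha> = a # parts \<alpha>'" "r > 0"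
  shows "strip_first r (fundamental_sum \<alpha>) = (if r \<le> a then sym_h (a - r) * fundamental_sum \<alpha>' else 0)"
    (is "?l = ?r")
proof (rule quasisymmetric_eqI)
  show "quasisymmetric ?r"
    by (simp add: quasisymmetric_mult quasisymmetric_sym_h quasisymmetric_fundamental_sum
        quasisymmetric_zero)
  fix \<beta>
  have "a > 0"
    using assms(1) parts[of \<alpha>] by (auto intro!: gr0I)
  then have l: "coeff ?l (mono_of (parts \<beta>)) = of_nat (if r \<le> a
      then \<Sum>(g, d)\<in>splits (parts \<beta>) (a - r). num_blocks (parts \<alpha>') d else 0)"
    using assms by (simp add: coeff_strip_first_mono_of coeff_fundamental_sum num_blocks_Cons)
  show "coeff ?l (mono_of (parts \<beta>)) = coeff ?r (mono_of (parts \<beta>))"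
  proof (cases "r \<le> a")
    case True
    let ?k = "a - r"
    let ?m = "mono_of (parts \<beta>)"
    have bij: "bij_betw (map_prod mono_of mono_of) (splits (parts \<beta>) ?k) {(c, d). c + d = ?m \<and> deg c = ?k}"
    proof (rule bij_betw_imageI)
      show "inj_on (map_prod mono_of mono_of) (splits (parts \<beta>) ?k)"
        by (rule inj_onI) (auto simp: splits_def mono_of_inject)
      show "map_prod mono_of mono_of ` splits (parts \<beta>) ?k = {(c, d). c + d = ?m \<and> deg c = ?k}"
      proof (intro set_eqI iffI)
        fix p
        assume "p \<in> map_prod mono_of mono_of ` splits (parts \<beta>) ?k"
        then obtain g d where "p = (mono_of g, mono_of d)" "(g, d) \<in> splits (parts \<beta>) ?k"
          by auto
        then show "p \<in> {(c, d). c + d = ?m \<and> deg c = ?k}"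
          using mono_of_map2_add[of g d] by (simp add: splits_def)
      next
        fix p
        assume "p \<in> {(c, d). c + d = ?m \<and> deg c = ?k}"
        then obtain c d where p: "p = (c, d)" "c + d = ?m" "deg c = ?k" by auto
        from mono_of_eq_add[OF p(2)] obtain g e where ge: "c = mono_of g" "d = mono_of e"
          "length g = length (parts \<beta>)" "length e = length (parts \<beta>)" "map2 (+) g e = parts \<beta>"
          by blast
        then have "(g, e) \<in> splits (parts \<beta>) ?k"
          using p(3) by (simp add: splits_def)
        then show "p \<in> map_prod mono_of mono_of ` splits (parts \<beta>) ?k"
          using p(1) ge(1,2) by (intro image_eqI[of _ _ "(g, e)"]) simp_all
      qed
    qed
    have "coeff ?r ?m = (\<Sum>(c, d) | c + d = ?m. coeff (sym_h ?k) c * coeff (fundamental_sum \<alpha>') d)"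
      using True by (simp add: coeff_mult)
    also have "\<dots> = (\<Sum>(c, d) | c + d = ?m \<and> deg c = ?k. coeff (fundamental_sum \<alpha>') d)"
      by (rule sum.mono_neutral_cong_right[OF finite_antidiagonal])
         (auto simp: sym_h.rep_eq split: if_splits)
    also have "\<dots> = (\<Sum>p\<in>splits (parts \<beta>) ?k. of_nat (num_blocks (parts \<alpha>') (snd p)))"
      by (subst sum.reindex_bij_betw[OF bij, symmetric])
         (simp add: case_prod_unfold coeff_fundamental_sum)
    finally show ?thesis
      using True l by (simp add: case_prod_unfold)
  qed (simp add: l zero_pseries.rep_eq)
qed (intro quasisymmetric_strip_first quasisymmetric_fundamental_sum)

lemma pairing_immaculate_fundamental_sum:
  "pairing (immaculate \<gamma>) (fundamental_sum \<alpha>) = (if \<gamma> = \<alpha> then 1 else 0)"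
proof -
  \<comment> \<open>The induction follows the composition of Bernstein operators.
    \<open>\<alpha>\<close> stays arbitrary, since each operator moves to the fundamental sum of a
    shorter composition.\<close>
  have "pairing (foldr (\<lambda>k. bernstein (int k)) xs 1) (fundamental_sum \<alpha>) = (if xs = parts \<alpha> then 1 else 0)"
    if "0 \<notin> set xs" for xs
    using that
  proof (induction xs arbitrary: \<alpha>)
    case Nil
    have "pairing 1 (fundamental_sum \<alpha>) = coeff (fundamental_sum \<alpha>) (mono_of [])"
      by (subst pairing_eq_sum[OF fundamental_sum_in_QSym, of "{0}"])
         (simp_all add: zero_composition.rep_eq flip: single_one)
    also have "\<dots> = of_nat (num_blocks (parts \<alpha>) [])"
      by (rule coeff_fundamental_sum)
    also have "\<dots> = (if [] = parts \<alpha> then 1 else 0)"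
    proof (cases "parts \<alpha>")
      case Nil
      then have "blocks (parts \<alpha>) [] = {[]}" by (auto simp: blocks_def)
      then show ?thesis using Nil by (simp add: num_blocks_def)
    next
      case (Cons a as)
      then have "a > 0" using parts[of \<alpha>] by (auto intro!: gr0I)
      then have "blocks (parts \<alpha>) [] = {}" by (auto simp: blocks_def Cons immaculate_word_Cons)
      then show ?thesis using Cons by (simp add: num_blocks_def)
    qed
    finally show ?case by simp
  next
    case (Cons m xs)
    have m: "m > 0" using Cons.prems by (auto intro!: gr0I)
    let ?h = "foldr (\<lambda>k. bernstein (int k)) xs 1"
    show ?case
    proof (cases "parts \<alpha>")
      case Nil
      then have "\<alpha> = 0" by (metis parts_inject zero_composition.rep_eq)
      \<comment> \<open>For the empty composition the Bernstein rule is used with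
        \<open>a = 0\<close> and \<open>G' = 0\<close>, so the required stripping is 0 for all
        \<open>r > 0\<close>.\<close>
      then have "pairing (bernstein (int m) ?h) (fundamental_sum \<alpha>)
          = (if m = 0 then pairing ?h 0 else 0)"
        using m strip_first_fundamental_sum_Nil
        by (intro pairing_bernstein[OF m fundamental_sum_in_QSym QSym_zero]) simp
      then show ?thesis using Nil m by simp
    next
      case Cons': (Cons a as)
      let ?\<alpha>' = "Abs_composition as"
      have \<alpha>': "parts ?\<alpha>' = as"
        using parts[of \<alpha>] Cons' by (auto simp: Abs_composition_inverse)
      have "pairing (bernstein (int m) ?h) (fundamental_sum \<alpha>)
          = (if m = a then pairing ?h (fundamental_sum ?\<alpha>') else 0)"
        using Cons' \<alpha>' strip_first_fundamental_sum_Cons[of \<alpha> a ?\<alpha>']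
        by (intro pairing_bernstein[OF m fundamental_sum_in_QSym fundamental_sum_in_QSym]) simp
      then show ?thesis
        using Cons.IH[of ?\<alpha>'] Cons.prems Cons' \<alpha>' by auto
    qed
  qed
  from this[of "parts \<gamma>"] show ?thesis
    using parts[of \<gamma>] by (simp add: immaculate_def parts_inject)
qed

text \<open>The \<open>fundamental_sum \<alpha>\<close> are independent since they are dual to the \<open>immaculate \<alpha>\<close>, and
  there are as many of them as monomial functions, so they span.\<close>

lemma QSym_deg_eq_0I:
  assumes f: "f \<in> QSym_deg n"
    and pair: "\<And>\<gamma>. comp_size \<gamma> = n \<Longrightarrow> pairing (immaculate \<gamma>) f = 0"
  shows "f = 0"
proof -
  let ?A = "{\<alpha>. comp_size \<alpha> = n}"
  let ?B = "fundamental_sum ` ?A"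
  have fin: "finite ?B" by (intro finite_imageI finite_compositions)
  have inj: "inj_on fundamental_sum ?A"
    by (rule inj_onI) (metis pairing_immaculate_fundamental_sum zero_neq_one)
  \<comment> \<open>Pairing with \<open>immaculate \<gamma>\<close> extracts one coefficient. This
    gives the independence, and at the end the vanishing of the coefficients of
    \<open>f\<close>.\<close>
  have pairing_sum: "pairing (immaculate \<gamma>) (\<Sum>x\<in>?B. pscale (u x) x) = u (fundamental_sum \<gamma>)"
    if "comp_size \<gamma> = n" for u \<gamma>
  proof -
    have "pairing (immaculate \<gamma>) (\<Sum>x\<in>?B. pscale (u x) x)
        = pairing (immaculate \<gamma>) (\<Sum>\<alpha>\<in>?A. pscale (u (fundamental_sum \<alpha>)) (fundamental_sum \<alpha>))"
      by (simp add: sum.reindex[OF inj])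
    also have "\<dots> = (\<Sum>\<alpha>\<in>?A. u (fundamental_sum \<alpha>) * (if \<gamma> = \<alpha> then 1 else 0))"
      by (simp add: pairing_sum_right QSym_pscale fundamental_sum_in_QSym pairing_pscale_right
          pairing_immaculate_fundamental_sum)
    also have "\<dots> = u (fundamental_sum \<gamma>)"
      using that by (simp add: if_distrib finite_compositions cong: if_cong)
    finally show ?thesis .
  qed
  have indep: "pseries.independent ?B"
  proof (rule pseries.independent_if_scalars_zero[OF fin])
    fix u x
    assume 0: "(\<Sum>x\<in>?B. pscale (u x) x) = 0" and "x \<in> ?B"
    then obtain \<gamma> where "x = fundamental_sum \<gamma>" "comp_size \<gamma> = n" by blast
    then show "u x = 0"
      using pairing_sum[of \<gamma> u] 0 by simp
  qed
  have "f \<in> pseries.span ?B"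
  proof (rule ccontr)
    assume not: "f \<notin> pseries.span ?B"
    have "pseries.independent (insert f ?B)"
      using not indep by (rule pseries.independent_insertI)
    moreover have "insert f ?B \<subseteq> pseries.span (qsym_M ` ?A)"
      using f fundamental_sum_in_QSym_deg unfolding QSym_deg_def by auto
    ultimately have "card (insert f ?B) \<le> card (qsym_M ` ?A)"
      using pseries.independent_span_bound finite_imageI[OF finite_compositions] by blast
    moreover have "f \<notin> ?B"
      using not pseries.span_base[of f ?B] by (rule contrapos_nn)
    then have "card (insert f ?B) = Suc (card ?A)"
      using card_insert_disjoint[OF fin] card_image[OF inj] by metis
    moreover have "card (qsym_M ` ?A) \<le> card ?A"
      by (rule card_image_le[OF finite_compositions])
    ultimately show False by linarith
  qed
  then obtain u where u: "f = (\<Sum>x\<in>?B. pscale (u x) x)"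
    unfolding pseries.span_finite[OF fin] by auto
  have "u x = 0" if x: "x \<in> ?B" for x
  proof -
    obtain \<gamma> where \<gamma>: "x = fundamental_sum \<gamma>" "comp_size \<gamma> = n"
      using x by blast
    then show ?thesis
      using pairing_sum[OF \<gamma>(2), of u] pair[OF \<gamma>(2)] by (simp flip: u)
  qed
  then show ?thesis
    unfolding u by (intro sum.neutral) simp
qed

text \<open>The difference between any solution of the defining conditions and
  \<open>fundamental_sum \<alpha>\<close> pairs to 0 with all immaculate functions of that degree,
  hence is 0; so the definite description denotes this series.\<close>

lemma dual_immaculate_eq: "dual_immaculate \<alpha> = fundamental_sum \<alpha>"
  unfolding dual_immaculate_def
proof (rule the_equality)
  show "fundamental_sum \<alpha> \<in> QSym_deg (comp_size \<alpha>) \<and> (\<forall>\<gamma>. comp_size \<gamma> = comp_size \<alpha> \<longrightarrow>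
      pairing (immaculate \<gamma>) (fundamental_sum \<alpha>) = (if \<gamma> = \<alpha> then 1 else 0))"
    by (simp add: fundamental_sum_in_QSym_deg pairing_immaculate_fundamental_sum)
next
  fix G
  assume G: "G \<in> QSym_deg (comp_size \<alpha>) \<and> (\<forall>\<gamma>. comp_size \<gamma> = comp_size \<alpha> \<longrightarrow>
      pairing (immaculate \<gamma>) G = (if \<gamma> = \<alpha> then 1 else 0))"
  let ?D = "pscale (- 1) (fundamental_sum \<alpha>) + G"
  have "?D = 0"
  proof (rule QSym_deg_eq_0I)
    show "?D \<in> QSym_deg (comp_size \<alpha>)"
      using G fundamental_sum_in_QSym_deg[of \<alpha>] unfolding QSym_deg_def
      by (intro pseries.span_add pseries.span_scale) auto
    fix \<gamma>
    assume "comp_size \<gamma> = comp_size \<alpha>"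
    have "pairing (immaculate \<gamma>) ?D
        = pairing (immaculate \<gamma>) (pscale (- 1) (fundamental_sum \<alpha>)) + pairing (immaculate \<gamma>) G"
      using G QSym_deg_subset by (intro pairing_add_right QSym_pscale fundamental_sum_in_QSym) auto
    also have "pairing (immaculate \<gamma>) (pscale (- 1) (fundamental_sum \<alpha>))
        = - 1 * pairing (immaculate \<gamma>) (fundamental_sum \<alpha>)"
      by (rule pairing_pscale_right[OF fundamental_sum_in_QSym])
    finally show "pairing (immaculate \<gamma>) ?D = 0"
      using G \<open>comp_size \<gamma> = comp_size \<alpha>\<close> by (simp add: pairing_immaculate_fundamental_sum)
  qed
  then show "G = fundamental_sum \<alpha>"
    by (simp add: eq_neg_iff_add_eq_0 add.commute)
qed

theorem theorem3p22:
  fixes \<alpha> :: composition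
  shows "dual_immaculate \<alpha> =
           (\<Sum>\<beta> | comp_size \<beta> = comp_size \<alpha> \<and> lex_le \<beta> \<alpha>.
              pscale (of_nat (L_coeff \<alpha> \<beta>)) (qsym_F \<beta>))
         \<and> fundamental_positive (dual_immaculate \<alpha>)"
proof
  show eq: "dual_immaculate \<alpha> = (\<Sum>\<beta> | comp_size \<beta> = comp_size \<alpha> \<and> lex_le \<beta> \<alpha>.
      pscale (of_nat (L_coeff \<alpha> \<beta>)) (qsym_F \<beta>))"
    unfolding dual_immaculate_eq fundamental_sum_def ..
  show "fundamental_positive (dual_immaculate \<alpha>)"
    unfolding fundamental_positive_def eq
    by (intro exI[of _ "{\<beta>. comp_size \<beta> = comp_size \<alpha> \<and> lex_le \<beta> \<alpha>}"]
        exI[of _ "\<lambda>\<beta>. of_nat (L_coeff \<alpha> \<beta>)"]) (simp add: finite_lex_le)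
qed

end
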